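(* Put $H:=I_n+A^\top A+A^\top C^\top CA$ and, for $X\in\mathbb{S}^n_+$, $Y\in\mathbb{S}^m_+$, $$\sigma^2(X,Y):=\begin{pmatrix}X & XC^\top\\ CX & CXC^\top+Y\end{pmatrix}.$$ Then for all $\bar Q\in\mathbb{S}^n_+$, $\bar R\in\mathbb{S}^m_+$, $\bar\Sigma\in\mathbb{S}^n_+$, the bicausal Wasserstein distance between the nominal law $\mathbb{P}$ and the alternative law $\bar{\mathbb{P}}=\bar{\mathbb{P}}^{\bar Q,\bar R,\bar\Sigma}$ is $\mathcal{W}_{bc}(\mathbb{P},\bar{\mathbb{P}})=w(\bar Q,\bar R,\bar\Sigma)$, where $$w(\bar Q,\bar R,\bar\Sigma):=\mathrm{tr}\Big[\sigma^2(Q,R)+\sigma^2(\bar Q,\bar R)-2\sqrt{\sqrt{\sigma^2(Q,R)}\,\sigma^2(\bar Q,\bar R)\sqrt{\sigma^2(Q,R)}}\Big]+\mathrm{tr}\Big[H\Sigma+H\bar\Sigma-2\sqrt{\sqrt{\Sigma}\,H\bar\Sigma H\sqrt{\Sigma}}\Big].$$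
   Context: Notation: $\mathbb{S}^n_+$, $\mathbb{S}^n_{++}$ are the symmetric positive semi-definite and positive definite $n\times n$ real matrices; $\sqrt X$ is the positive semi-definite square root of $X\in\mathbb{S}^n_+$; $I_n$ is the identity. Setting: a time $t$ and observations $y_{1:t-1}$ are fixed; everything is conditional on $y_{1:t-1}$. Write $A=A_t\in\mathbb{R}^{n\times n}$, $C=C_t\in\mathbb{R}^{m\times n}$, $Q=Q_t\in\mathbb{S}^n_{++}$, $R=R_t\in\mathbb{S}^m_{++}$, $\Sigma=\Sigma_{t-1}\in\mathbb{S}^n_{++}$, $\hat x=\hat x_{t-1}\in\mathbb{R}^n$; these are given. Nominal law $\mathbb{P}$: the law of $(x_{t-1},x_t,y_t)\in\mathbb{R}^n\times\mathbb{R}^n\times\mathbb{R}^m$ where $x_{t-1}\sim N(\hat x,\Sigma)$, $x_t=Ax_{t-1}+w_t$, $y_t=Cx_t+v_t$, with $w_t\sim N(0,Q)$, $v_t\sim N(0,R)$ and $x_{t-1},w_t,v_t$ independent. It is assumed that the covariance matrix of $(x_t,y_t)$ under $\mathbb{P}$ is positive definite. Alternative law $\bar{\mathbb{P}}^{\bar Q,\bar R,\bar\Sigma}$: the law of $(\bar x_{t-1},\bar x_t,\bar y_t)$ where $\bar x_{t-1}\sim N(\hat x,\bar\Sigma)$, $\bar x_t=A\bar x_{t-1}+\bar w_t$, $\bar y_t=C\bar x_t+\bar v_t$, with $\bar w_t\sim N(0,\bar Q)$, $\bar v_t\sim N(0,\bar R)$ and $\bar x_{t-1},\bar w_t,\bar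 v_t$ independent (same $\hat x$, $A$, $C$). Bicausal couplings: $\Pi_{bc}(\mathbb{P},\bar{\mathbb{P}})$ is the set of couplings $\pi$ of $\mathbb{P}$ and $\bar{\mathbb{P}}$ such that, $\pi$-a.s., $\pi(d\bar x_{t-1}\mid x_{t-1},x_t,y_t)=\pi(d\bar x_{t-1}\mid x_{t-1})$ and $\pi(dx_{t-1}\mid\bar x_{t-1},\bar x_t,\bar y_t)=\pi(dx_{t-1}\mid\bar x_{t-1})$. The bicausal Wasserstein distance is $$\mathcal{W}_{bc}(\mathbb{P},\bar{\mathbb{P}}):=\inf_{\pi\in\Pi_{bc}(\mathbb{P},\bar{\mathbb{P}})}\int\big(\|x_{t-1}-\bar x_{t-1}\|^2+\|x_t-\bar x_t\|^2+\|y_t-\bar y_t\|^2\big)\,d\pi .$$ *)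

theory Defs
  imports "HOL-Probability.Probability"
begin

definition psd :: "real^'k^'k \<Rightarrow> bool" where
  "psd X \<longleftrightarrow> transpose X = X \<and> (\<forall>v. 0 \<le> v \<bullet> (X *v v))"

definition pd :: "real^'k^'k \<Rightarrow> bool" where
  "pd X \<longleftrightarrow> transpose X = X \<and> (\<forall>v. v \<noteq> 0 \<longrightarrow> 0 < v \<bullet> (X *v v))"

text \<open>Meaningful for positive semi-definite arguments only, where the root exists and is unique.\<close>

definition psd_sqrt :: "real^'k^'k \<Rightarrow> real^'k^'k" where
  "psd_sqrt X = (THE B. psd B \<and> B ** B = X)"

definition std_gaussian :: "(real^'k) measure" where
  "std_gaussian = density lborel (\<lambda>z. \<Prod>i\<in>UNIV. ennreal (normal_density 0 1 (z $ i)))"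

text \<open>\<open>N(mu, S)\<close> for \<open>psd S\<close>. The covariance may be singular, so the law is defined as that
  of \<open>mu + sqrt S z\<close> with \<open>z\<close> standard normal, and not by a density.\<close>

definition gaussian :: "real^'k \<Rightarrow> real^'k^'k \<Rightarrow> (real^'k) measure" where
  "gaussian mu S = distr std_gaussian borel (\<lambda>z. mu + psd_sqrt S *v z)"

text \<open>The law of \<open>(x, A x + w, C (A x + w) + v)\<close> for independent
  \<open>x \<sim> N(xhat, S)\<close>, \<open>w \<sim> N(0, Q)\<close>, \<open>v \<sim> N(0, R)\<close>.\<close>

definition state_obs_law ::
  "real^'n^'n \<Rightarrow> real^'n^'m \<Rightarrow> real^'n \<Rightarrow> real^'n^'n \<Rightarrow> real^'m^'m \<Rightarrow> real^'n^'n
    \<Rightarrow> ((real^'n) \<times> (real^'n) \<times> (real^'m)) measure" where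
  "state_obs_law A C xhat Q R S =
     distr (gaussian xhat S \<Otimes>\<^sub>M (gaussian 0 Q \<Otimes>\<^sub>M gaussian 0 R)) borel
       (\<lambda>(x, w, v). (x, A *v x + w, C *v (A *v x + w) + v))"

definition stack :: "real^'n \<Rightarrow> real^'m \<Rightarrow> real^('n + 'm)" where
  "stack a b = (\<chi> i. case i of Inl p \<Rightarrow> a $ p | Inr q \<Rightarrow> b $ q)"

definition block_matrix ::
  "real^'n^'n \<Rightarrow> real^'m^'n \<Rightarrow> real^'n^'m \<Rightarrow> real^'m^'m \<Rightarrow> real^('n + 'm)^('n + 'm)" where
  "block_matrix X11 X12 X21 X22 =
     (\<chi> i j. case i of
         Inl p \<Rightarrow> (case j of Inl q \<Rightarrow> X11 $ p $ q | Inr q \<Rightarrow> X12 $ p $ q)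
       | Inr p \<Rightarrow> (case j of Inl q \<Rightarrow> X21 $ p $ q | Inr q \<Rightarrow> X22 $ p $ q))"

definition covariance_matrix :: "'a measure \<Rightarrow> ('a \<Rightarrow> real^'k) \<Rightarrow> real^'k^'k" where
  "covariance_matrix M Z =
     (\<chi> i j. \<integral>\<omega>. (Z \<omega> $ i - (\<integral>\<omega>'. Z \<omega>' $ i \<partial>M)) * (Z \<omega> $ j - (\<integral>\<omega>'. Z \<omega>' $ j \<partial>M)) \<partial>M)"

text \<open>Regular conditional law of \<open>Y\<close> given \<open>X\<close>, as a Markov kernel disintegrating the joint law of \<open>(X, Y)\<close>
  over the law of \<open>X\<close>.\<close>

definition is_cond_law ::
  "'w measure \<Rightarrow> ('w \<Rightarrow> 'y::topological_space) \<Rightarrow> ('w \<Rightarrow> 'x::topological_space)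
    \<Rightarrow> ('x \<Rightarrow> 'y measure) \<Rightarrow> bool" where
  "is_cond_law \<pi> Y X \<kappa> \<longleftrightarrow>
     \<kappa> \<in> borel \<rightarrow>\<^sub>M prob_algebra borel \<and>
     (\<forall>U\<in>sets borel. \<forall>B\<in>sets borel.
        emeasure \<pi> {\<omega> \<in> space \<pi>. X \<omega> \<in> U \<and> Y \<omega> \<in> B} =
        (\<integral>\<^sup>+\<omega>. indicator U (X \<omega>) * emeasure (\<kappa> (X \<omega>)) B \<partial>\<pi>))"

text \<open>\<open>\<pi>(dY | X) = \<pi>(dY | X')\<close> almost surely. On Euclidean spaces regular conditional laws exist and
  are unique up to null sets, so the choice of versions is immaterial.\<close>

definition same_cond_law ::
  "'w measure \<Rightarrow> ('w \<Rightarrow> 'y::topological_space) \<Rightarrow> ('w \<Rightarrow> 'x::topological_space)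
    \<Rightarrow> ('w \<Rightarrow> 'z::topological_space) \<Rightarrow> bool" where
  "same_cond_law \<pi> Y X X' \<longleftrightarrow>
     (\<exists>\<kappa> \<kappa>'. is_cond_law \<pi> Y X \<kappa> \<and> is_cond_law \<pi> Y X' \<kappa>' \<and>
        (AE \<omega> in \<pi>. \<kappa> (X \<omega>) = \<kappa>' (X' \<omega>)))"

definition couplings ::
  "'a::topological_space measure \<Rightarrow> 'b::topological_space measure \<Rightarrow> ('a \<times> 'b) measure set" where
  "couplings P P' =
     {\<pi> \<in> space (prob_algebra borel). distr \<pi> borel fst = P \<and> distr \<pi> borel snd = P'}"

text \<open>A point of the coupling space is \<open>((x0, x1, y), (x0', x1', y'))\<close>, so \<open>fst \<circ> fst\<close> and
  \<open>fst \<circ> snd\<close> are the two initial states.\<close>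

definition bicausal_couplings ::
  "((real^'n) \<times> (real^'n) \<times> (real^'m)) measure \<Rightarrow> ((real^'n) \<times> (real^'n) \<times> (real^'m)) measure
    \<Rightarrow> (((real^'n) \<times> (real^'n) \<times> (real^'m)) \<times> ((real^'n) \<times> (real^'n) \<times> (real^'m))) measure set" where
  "bicausal_couplings P P' =
     {\<pi> \<in> couplings P P'.
        same_cond_law \<pi> (fst \<circ> snd) fst (fst \<circ> fst) \<and>
        same_cond_law \<pi> (fst \<circ> fst) snd (fst \<circ> snd)}"

definition W_bc ::
  "((real^'n) \<times> (real^'n) \<times> (real^'m)) measure \<Rightarrow> ((real^'n) \<times> (real^'n) \<times> (real^'m)) measure \<Rightarrow> ennreal"
where
  "W_bc P P' =
     (INF \<pi>\<in>bicausal_couplings P P'.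
        \<integral>\<^sup>+((x0, x1, y), (x0', x1', y')).
          ennreal ((norm (x0 - x0'))\<^sup>2 + (norm (x1 - x1'))\<^sup>2 + (norm (y - y'))\<^sup>2) \<partial>\<pi>)"

definition H_mat :: "real^'n^'n \<Rightarrow> real^'n^'m \<Rightarrow> real^'n^'n" where
  "H_mat A C = mat 1 + transpose A ** A + transpose A ** transpose C ** C ** A"

definition sigma2 :: "real^'n^'m \<Rightarrow> real^'n^'n \<Rightarrow> real^'m^'m \<Rightarrow> real^('n + 'm)^('n + 'm)" where
  "sigma2 C X Y = block_matrix X (X ** transpose C) (C ** X) (C ** X ** transpose C + Y)"

definition w_formula ::
  "real^'n^'n \<Rightarrow> real^'n^'m \<Rightarrow> real^'n^'n \<Rightarrow> real^'m^'m \<Rightarrow> real^'n^'n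
    \<Rightarrow> real^'n^'n \<Rightarrow> real^'m^'m \<Rightarrow> real^'n^'n \<Rightarrow> real" where
  "w_formula A C Q R S Q' R' S' =
     trace (sigma2 C Q R + sigma2 C Q' R'
       - 2 *\<^sub>R psd_sqrt (psd_sqrt (sigma2 C Q R) ** sigma2 C Q' R' ** psd_sqrt (sigma2 C Q R)))
     + trace (H_mat A C ** S + H_mat A C ** S'
       - 2 *\<^sub>R psd_sqrt (psd_sqrt S ** H_mat A C ** S' ** H_mat A C ** psd_sqrt S))"

end

theory Submission
  imports Defs
begin

text \<open>Write \<open>e = x\<^sub>0 - x\<^sub>0'\<close> for the difference of the initial states of two coupled paths,
  \<open>\<xi> = (w, C w + v)\<close> and \<open>\<xi>'\<close> for the contributions of their noises to \<open>(x\<^sub>1, y)\<close>, and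
  \<open>D = (A, C A)\<close> for the response to the initial state. The cost is \<open>|e|\<^sup>2 + |\<xi> - \<xi>' + D e|\<^sup>2\<close>, and
  \<open>H = I + D\<^sup>T D\<close>. Bicausality makes the initial state of either path independent of the noise of the
  other one (\<open>same_cond_law_imp_indep_noise\<close>), so the mixed terms have expectation zero and the cost
  of every bicausal coupling is the constant
  \<open>trace (H S + H S' + sigma2 + sigma2')\<close> minus twice the sum of the two correlations
  \<open>E[(x\<^sub>0 - xhat) \<bullet> H (x\<^sub>0' - xhat)]\<close> and \<open>E[\<xi> \<bullet> \<xi>']\<close> (\<open>bicausal_coupling_cost\<close>).

  Each correlation is at most the trace of a root of the form
  \<open>sqrt (sqrt S1 S2 sqrt S1)\<close> in terms of the two second moment matrices (\<open>gelbrich_bound\<close>); this only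
  uses the Cauchy-Schwarz inequality in an eigenbasis. That proves the lower bound on the distance.

  Both bounds are attained at once by a Gaussian coupling built from orthogonal matrices \<open>W\<close> such that
  \<open>N W = sqrt (N N\<^sup>T)\<close> (\<open>polar_decomposition\<close>). When the covariance of \<open>x\<^sub>0'\<close> is singular, \<open>x\<^sub>0\<close> is
  not a function of \<open>x\<^sub>0'\<close>; its conditional law is made explicit by resampling the component of the
  Gaussian vector that \<open>x\<^sub>0'\<close> does not see (\<open>optimal_bicausal_coupling\<close>).

  The ingredients from linear algebra are a spectral theorem for symmetric matrices, existence and
  uniqueness of positive semi-definite roots, and the polar decomposition; the last one, and each
  eigenvector, is obtained from a maximiser on a compact set. The decisive property of the standard
  Gaussian law is its invariance under orthogonal maps.\<close>

section \<open>Orthogonal matrices and the spectral theorem\<close>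

lemma dot_mult_transpose: "u \<bullet> (A *v v) = (transpose A *v u) \<bullet> v" for A :: "real^'n^'m"
  by (simp add: dot_lmul_matrix)

lemma mult_dot_transpose: "(A *v u) \<bullet> v = u \<bullet> (transpose A *v v)" for A :: "real^'n^'m"
  by (metis dot_mult_transpose transpose_transpose)

lemma axis_dot_mult_axis: "axis i 1 \<bullet> (A *v axis j 1) = A $ i $ j" for A :: "real^'n^'m"
  by (simp add: matrix_vector_mult_basis column_def inner_axis')

lemma matrix_eq_dotI:
  fixes A B :: "real^'n^'m"
  assumes "\<And>u v. u \<bullet> (A *v v) = u \<bullet> (B *v v)"
  shows "A = B"
  using assms by (metis vector_eq_rdot matrix_eq inner_commute)

lemma matrix_diff_ldistrib: "A ** (B - C) = A ** B - A ** C" for A :: "real^'n^'m"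
  by (simp add: matrix_matrix_mult_def vec_eq_iff sum_subtractf right_diff_distrib)

lemma matrix_diff_rdistrib: "(B - C) ** A = B ** A - C ** A" for A :: "real^'n^'m"
  by (simp add: matrix_matrix_mult_def vec_eq_iff sum_subtractf left_diff_distrib)

lemma matrix_mult_scaleR_right: "A ** (c *\<^sub>R B) = c *\<^sub>R (A ** B)" for A :: "real^'n^'m"
  by (simp add: matrix_scalar_ac scalar_matrix_assoc)

lemma psd_gram: "psd (A ** transpose A)" for A :: "real^'n^'m"
  unfolding psd_def
  by (simp add: matrix_transpose_mul matrix_vector_mul_assoc[symmetric] dot_mult_transpose)

lemma psd_congruence:
  fixes A :: "real^'n^'m"
  assumes "psd X"
  shows "psd (A ** X ** transpose A)"
proof -
  have X: "transpose X = X" "\<And>v. 0 \<le> v \<bullet> (X *v v)"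
    using assms by (auto simp: psd_def)
  have "0 \<le> v \<bullet> ((A ** X ** transpose A) *v v)" for v
    using X(2)[of "transpose A *v v"]
    by (simp add: matrix_vector_mul_assoc[symmetric] dot_mult_transpose[of v A])
  then show ?thesis
    by (simp add: psd_def matrix_transpose_mul X(1) matrix_mul_assoc)
qed

lemma pd_imp_psd: "pd X \<Longrightarrow> psd X"
  unfolding pd_def psd_def by (metis inner_zero_left less_eq_real_def)

lemma pd_imp_invertible:
  assumes "pd X"
  shows "invertible X"
proof -
  have "X *v x = 0 \<Longrightarrow> x = 0" for x
    using assms unfolding pd_def by (metis inner_zero_right less_irrefl)
  then show ?thesis
    using invertible_left_inverse matrix_left_invertible_ker by blast
qed

text \<open>The first-order condition at a maximum, for quadratic polynomials.\<close>

lemma linear_term_zero_of_nonpos: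
  fixes a b :: real
  assumes "\<And>t. t * a + t\<^sup>2 * b \<le> 0"
  shows "a = 0"
proof (rule ccontr)
  assume "a \<noteq> 0"
  define c where "c = \<bar>b\<bar> + 1"
  have c: "0 < c" "\<bar>b\<bar> < c" unfolding c_def by auto
  have "(a / c) * a + (a / c)\<^sup>2 * b = (a\<^sup>2 / c) * (1 + b / c)"
    using c by (simp add: field_simps power2_eq_square)
  moreover have "0 < 1 + b / c"
    using c by (simp add: field_simps)
  moreover have "0 < a\<^sup>2 / c"
    using c \<open>a \<noteq> 0\<close> by simp
  ultimately have "0 < (a / c) * a + (a / c)\<^sup>2 * b"
    by (metis mult_pos_pos)
  then show False using assms[of "a / c"] by linarith
qed

text \<open>A symmetric matrix has an eigenvector in every nontrivial invariant subspace: a maximiser of the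
  Rayleigh quotient.\<close>

lemma symmetric_eigenvector_exists:
  fixes X :: "real^'k^'k"
  assumes X: "transpose X = X" and W: "subspace W" and inv: "\<And>w. w \<in> W \<Longrightarrow> X *v w \<in> W"
    and ne: "w0 \<in> W" "w0 \<noteq> 0"
  obtains u l where "u \<in> W" "norm u = 1" "X *v u = l *\<^sub>R u"
proof -
  let ?S = "sphere 0 1 \<inter> W"
  have "compact ?S"
    using W by (intro compact_Int_closed closed_subspace) auto
  moreover have "inverse (norm w0) *\<^sub>R w0 \<in> ?S"
    using ne W by (auto simp: subspace_scale)
  then have "?S \<noteq> {}" by blast
  moreover have "continuous_on ?S (\<lambda>v. v \<bullet> (X *v v))"
    by (intro continuous_intros)
  ultimately obtain u where u: "u \<in> ?S" and max: "\<And>v. v \<in> ?S \<Longrightarrow> v \<bullet> (X *v v) \<le> u \<bullet> (X *v u)"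
    using continuous_attains_sup by meson
  define l where "l = u \<bullet> (X *v u)"
  have uu: "u \<bullet> u = 1" using u by (simp add: dot_square_norm)
  have le: "v \<bullet> (X *v v) \<le> l * (v \<bullet> v)" if "v \<in> W" for v
  proof (cases "v = 0")
    case False
    then have "inverse (norm v) *\<^sub>R v \<in> ?S"
      using that W by (auto simp: subspace_scale)
    from max[OF this] have "inverse (norm v) * (inverse (norm v) * (v \<bullet> (X *v v))) \<le> l"
      by (simp add: matrix_vector_mult_scaleR l_def)
    then show ?thesis
      using False by (simp add: dot_square_norm field_simps power2_eq_square)
  qed simp
  have sym: "u \<bullet> (X *v w) = w \<bullet> (X *v u)" for w
    by (metis X dot_mult_transpose inner_commute)
  have orth: "w \<bullet> (X *v u - l *\<^sub>R u) = 0" if w: "w \<in> W" for w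
  proof -
    have "t * (2 * (w \<bullet> (X *v u) - l * (w \<bullet> u))) + t\<^sup>2 * (w \<bullet> (X *v w) - l * (w \<bullet> w)) \<le> 0" for t
    proof -
      have "u + t *\<^sub>R w \<in> W" using u w W by (simp add: subspace_add subspace_scale)
      note * = le[OF this]
      have 1: "(u + t *\<^sub>R w) \<bullet> (X *v (u + t *\<^sub>R w))
          = l + 2 * t * (w \<bullet> (X *v u)) + t\<^sup>2 * (w \<bullet> (X *v w))"
        using sym[of w]
        by (simp add: matrix_vector_right_distrib matrix_vector_mult_scaleR inner_add_left
            inner_add_right l_def power2_eq_square algebra_simps)
      have 2: "(u + t *\<^sub>R w) \<bullet> (u + t *\<^sub>R w) = 1 + 2 * t * (w \<bullet> u) + t\<^sup>2 * (w \<bullet> w)"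
        by (simp add: inner_add_left inner_add_right uu inner_commute[of u w] power2_eq_square algebra_simps)
      from *[unfolded 1 2] show ?thesis by (simp add: algebra_simps)
    qed
    from linear_term_zero_of_nonpos[OF this] show ?thesis
      by (simp add: inner_diff_right)
  qed
  have "X *v u - l *\<^sub>R u \<in> W"
    using u inv W by (simp add: subspace_diff subspace_scale)
  from orth[OF this] have "X *v u = l *\<^sub>R u" by simp
  with that u show thesis by auto
qed

text \<open>The matrix with the entries of \<open>d\<close> on the diagonal.\<close>

definition diag_matrix :: "('k \<Rightarrow> real) \<Rightarrow> real^'k^'k" where
  "diag_matrix d = (\<chi> i j. if i = j then d i else 0)"

lemma diag_matrix_mult_vec: "diag_matrix d *v x = (\<chi> i. d i * x $ i)"
  by (simp add: diag_matrix_def matrix_vector_mult_def vec_eq_iff if_distrib if_distribR cong: if_cong)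

lemma transpose_diag_matrix [simp]: "transpose (diag_matrix d) = diag_matrix d"
  by (simp add: diag_matrix_def transpose_def vec_eq_iff)

lemma diag_matrix_mult: "diag_matrix c ** diag_matrix d = diag_matrix (\<lambda>i. c i * d i)"
  by (rule matrix_eq[THEN iffD2])
     (simp add: matrix_vector_mul_assoc[symmetric] diag_matrix_mult_vec mult.assoc)

lemma psd_diag_matrix: "(\<And>i. 0 \<le> d i) \<Longrightarrow> psd (diag_matrix d)"
  by (simp add: psd_def diag_matrix_mult_vec inner_vec_def mult.left_commute[of "_ $ _"] sum_nonneg)

text \<open>An orthonormal set of eigenvectors of maximal size spans the space: its orthogonal complement is
  invariant and would otherwise contain a further eigenvector.\<close>

theorem spectral_decomposition:
  fixes X :: "real^'k^'k"
  assumes X: "transpose X = X"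
  obtains V d where "orthogonal_matrix V" "X = V ** diag_matrix d ** transpose V"
proof -
  let ?P = "\<lambda>E. pairwise orthogonal E \<and> (\<forall>e\<in>E. norm e = 1 \<and> (\<exists>l. X *v e = l *\<^sub>R e))"
  have indep: "independent E" if "?P E" for E
    by (rule pairwise_orthogonal_independent) (use that in auto)
  let ?C = "\<lambda>m. \<exists>E. ?P E \<and> card E = m"
  have "?C 0" by (intro exI[of _ "{}"]) auto
  moreover have "m \<le> DIM(real^'k)" if "?C m" for m
    using that indep independent_bound by blast
  ultimately obtain m where m: "?C m" "\<And>n. ?C n \<Longrightarrow> n \<le> m"
    using GreatestI_nat[of ?C 0 "DIM(real^'k)"] Greatest_le_nat[of ?C _ "DIM(real^'k)"] by blast
  then obtain E where E: "?P E" "card E = m" by blast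
  have fin: "finite E" using indep[OF E(1)] independent_bound by blast
  let ?W = "{w. \<forall>e\<in>E. e \<bullet> w = 0}"
  have W0: "w = 0" if w: "w \<in> ?W" for w
  proof (rule ccontr)
    assume "w \<noteq> 0"
    have sub: "subspace ?W" by (auto simp: subspace_def inner_add_right)
    have inv: "X *v v \<in> ?W" if "v \<in> ?W" for v
    proof safe
      fix e assume e: "e \<in> E"
      then obtain l where "X *v e = l *\<^sub>R e" using E by blast
      moreover have "e \<bullet> (X *v v) = (X *v e) \<bullet> v" by (metis X dot_mult_transpose)
      ultimately show "e \<bullet> (X *v v) = 0" using that e by simp
    qed
    obtain u l where u: "u \<in> ?W" "norm u = 1" "X *v u = l *\<^sub>R u"
      by (rule symmetric_eigenvector_exists[OF X sub inv w \<open>w \<noteq> 0\<close>])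
    have "u \<notin> E" using u by fastforce
    moreover have "?P (insert u E)"
      using E u by (auto simp: pairwise_insert orthogonal_def inner_commute)
    moreover have "card (insert u E) = Suc m"
      using E fin \<open>u \<notin> E\<close> by simp
    ultimately have "?C (Suc m)" by blast
    then show False using m(2) by fastforce
  qed
  have "span E = UNIV"
  proof (rule ccontr)
    assume "span E \<noteq> UNIV"
    then obtain a where a: "a \<noteq> 0" "\<forall>x\<in>span E. a \<bullet> x = 0"
      using span_not_univ_subset_hyperplane[of E] by auto
    then have "a \<in> ?W" by (auto simp: inner_commute span_base)
    with W0 a show False by blast
  qed
  then have "card E = CARD('k)"
    using indep[OF E(1)] by (metis DIM_cart DIM_real dim_UNIV dim_eq_card_independent dim_span mult.right_neutral)
  then obtain f :: "'k \<Rightarrow> real^'k" where f: "bij_betw f UNIV E"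
    using fin by (metis finite_class.finite_UNIV finite_same_card_bij)
  then have fE: "f i \<in> E" for i by (auto simp: bij_betw_def)
  then have "\<forall>i. \<exists>l. X *v f i = l *\<^sub>R f i" using E by blast
  then obtain d where d: "\<And>i. X *v f i = d i *\<^sub>R f i" by metis
  define V where "V = (\<chi> i j. f j $ i)"
  have colV: "column j V = f j" for j by (simp add: V_def column_def vec_eq_iff)
  have V: "orthogonal_matrix V"
    unfolding orthogonal_matrix_orthonormal_columns colV
  proof (intro conjI allI impI)
    show "norm (f i) = 1" for i using E fE by blast
    show "orthogonal (f i) (f j)" if "i \<noteq> j" for i j
      using E fE that f by (metis bij_betw_def inj_eq pairwise_def)
  qed
  have "X ** V = V ** diag_matrix d"
  proof -
    have "(X ** V) *v axis j 1 = (V ** diag_matrix d) *v axis j 1" for j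
    proof -
      have "diag_matrix d *v axis j 1 = d j *\<^sub>R axis j 1"
        by (auto simp: diag_matrix_mult_vec vec_eq_iff axis_def)
      then show ?thesis
        using matrix_vector_mult_basis[of V j]
        by (simp add: matrix_vector_mul_assoc[symmetric] colV d matrix_vector_mult_scaleR
            del: matrix_vector_mult_basis)
    qed
    then have "column j (X ** V) = column j (V ** diag_matrix d)" for j
      by (simp only: matrix_vector_mult_basis)
    then show ?thesis by (simp add: column_def vec_eq_iff)
  qed
  then have "X = V ** diag_matrix d ** transpose V"
    using V by (metis matrix_mul_assoc matrix_mul_rid orthogonal_matrix_def)
  with V that show thesis by blast
qed

lemma spectral_form_column:
  fixes V :: "real^'k^'k"
  assumes "orthogonal_matrix V"
  shows "column i V \<bullet> ((V ** diag_matrix d ** transpose V) *v column i V) = d i"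
proof -
  have "transpose V *v column i V = axis i 1"
    using assms
    by (metis matrix_vector_mul_assoc matrix_vector_mul_lid matrix_vector_mult_basis orthogonal_matrix)
  then show ?thesis
    by (simp add: matrix_vector_mul_assoc[symmetric] dot_mult_transpose[of _ V] diag_matrix_mult_vec
        inner_axis' del: transpose_matrix_vector)
qed

section \<open>Positive semi-definite square roots\<close>

lemma trace_as_sum_dot: "trace X = (\<Sum>i\<in>UNIV. axis i 1 \<bullet> (X *v axis i 1))" for X :: "real^'k^'k"
  by (simp add: trace_def axis_dot_mult_axis)

lemma psd_trace_nonneg: "psd X \<Longrightarrow> 0 \<le> trace X"
  unfolding trace_as_sum_dot psd_def by (auto intro: sum_nonneg)

lemma psd_form_zero_imp_kernel:
  assumes "psd B" and "v \<bullet> (B *v v) = 0"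
  shows "B *v v = 0"
proof -
  have B: "transpose B = B" "\<And>v. 0 \<le> v \<bullet> (B *v v)"
    using assms by (auto simp: psd_def)
  have "w \<bullet> (B *v v) = 0" for w
  proof -
    have "t * (- 2 * (w \<bullet> (B *v v))) + t\<^sup>2 * - (w \<bullet> (B *v w)) \<le> 0" for t
    proof -
      have "v \<bullet> (B *v w) = w \<bullet> (B *v v)" by (metis B(1) dot_mult_transpose inner_commute)
      then show ?thesis
        using B(2)[of "v + t *\<^sub>R w"] assms(2)
        by (simp add: algebra_simps matrix_vector_mult_scaleR inner_add_left inner_add_right
            power2_eq_square)
    qed
    from linear_term_zero_of_nonpos[OF this] show ?thesis by simp
  qed
  then show ?thesis by (metis inner_eq_zero_iff)
qed

text \<open>With \<open>D = B - C\<close>, the equality of squares gives \<open>B D + D C = 0\<close>; multiplying by \<open>D\<close> and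
  taking traces, the nonnegative numbers \<open>trace (D B D)\<close> and \<open>trace (D C D)\<close> add up to zero.\<close>

lemma psd_square_inj:
  fixes B C :: "real^'k^'k"
  assumes B: "psd B" and C: "psd C" and eq: "B ** B = C ** C"
  shows "B = C"
proof -
  define D where "D = B - C"
  have tD: "transpose D = D"
    using B C by (simp add: D_def psd_def transpose_def vec_eq_iff)
  have ann: "P ** D = 0" if P: "psd P" and tr: "trace (D ** P ** D) = 0" for P
  proof -
    have pos: "0 \<le> axis i 1 \<bullet> ((D ** P ** D) *v axis i 1)" for i
      using psd_congruence[OF P, of D] tD by (simp add: psd_def)
    have "axis i 1 \<bullet> ((D ** P ** D) *v axis i 1) = 0" for i
      using tr pos unfolding trace_as_sum_dot by (simp add: sum_nonneg_eq_0_iff)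
    then have "(D *v axis i 1) \<bullet> (P *v (D *v axis i 1)) = 0" for i
      by (simp add: matrix_vector_mul_assoc[symmetric] mult_dot_transpose tD
          del: transpose_matrix_vector)
    then have "P *v (D *v axis i 1) = 0" for i
      using psd_form_zero_imp_kernel[OF P] by blast
    then have "column i (P ** D) = 0" for i
      by (simp add: matrix_vector_mult_basis[symmetric] matrix_vector_mul_assoc[symmetric])
    then show ?thesis by (simp add: column_def vec_eq_iff)
  qed
  have "B ** D + D ** C = 0"
    by (simp add: D_def matrix_diff_ldistrib matrix_diff_rdistrib eq)
  then have "trace (D ** (B ** D + D ** C)) = 0" by (simp add: trace_def)
  moreover have "trace (D ** (B ** D + D ** C)) = trace (D ** B ** D) + trace (D ** C ** D)"
    by (metis matrix_add_ldistrib matrix_mul_assoc trace_add trace_mul_sym)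
  moreover have "0 \<le> trace (D ** B ** D)" "0 \<le> trace (D ** C ** D)"
    using psd_congruence[OF B, of D] psd_congruence[OF C, of D] tD
    by (auto intro: psd_trace_nonneg)
  ultimately have "B ** D = 0" "C ** D = 0"
    using ann B C by auto
  then have "D ** D = 0" by (metis D_def diff_zero matrix_diff_rdistrib)
  then have "(D *v v) \<bullet> (D *v v) = 0" for v
    by (simp add: mult_dot_transpose tD matrix_vector_mul_assoc del: transpose_matrix_vector)
  then have "D *v v = 0" for v by simp
  then have "D = 0" by (simp add: matrix_eq)
  then show ?thesis by (simp add: D_def)
qed

lemma psd_sqrt_unique: "psd B \<Longrightarrow> B ** B = X \<Longrightarrow> psd_sqrt X = B"
  unfolding psd_sqrt_def by (rule the_equality) (auto intro: psd_square_inj)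

lemma psd_sqrt_spectral:
  fixes X :: "real^'k^'k"
  assumes "psd X"
  obtains V s where "orthogonal_matrix V" "\<And>i. 0 \<le> s i"
    "psd_sqrt X = V ** diag_matrix s ** transpose V"
    "X = V ** diag_matrix (\<lambda>i. (s i)\<^sup>2) ** transpose V"
proof -
  obtain V d where V: "orthogonal_matrix V" and Xd: "X = V ** diag_matrix d ** transpose V"
    using assms spectral_decomposition by (metis psd_def)
  have "0 \<le> d i" for i
    using spectral_form_column[OF V, of i d] assms unfolding Xd[symmetric] psd_def by metis
  then have sq: "(sqrt (d i))\<^sup>2 = d i" for i by simp
  let ?B = "V ** diag_matrix (\<lambda>i. sqrt (d i)) ** transpose V"
  have "psd ?B" by (intro psd_congruence psd_diag_matrix) (simp add: \<open>\<And>i. 0 \<le> d i\<close>)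
  moreover have "?B ** ?B = V ** (diag_matrix (\<lambda>i. sqrt (d i)) ** (transpose V ** V) **
      diag_matrix (\<lambda>i. sqrt (d i))) ** transpose V"
    by (simp add: matrix_mul_assoc)
  then have "?B ** ?B = X"
    using V \<open>\<And>i. 0 \<le> d i\<close> by (simp add: orthogonal_matrix diag_matrix_mult Xd)
  ultimately have "psd_sqrt X = ?B" by (rule psd_sqrt_unique)
  then show thesis
    using that[of V "\<lambda>i. sqrt (d i)"] V Xd sq \<open>\<And>i. 0 \<le> d i\<close> by simp
qed

lemma psd_psd_sqrt: "psd X \<Longrightarrow> psd (psd_sqrt X)"
  and psd_sqrt_square: "psd X \<Longrightarrow> psd_sqrt X ** psd_sqrt X = X"
proof -
  assume "psd X"
  then obtain V s where V: "orthogonal_matrix V" and s: "\<And>i. 0 \<le> s i"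
    and B: "psd_sqrt X = V ** diag_matrix s ** transpose V"
    and X: "X = V ** diag_matrix (\<lambda>i. (s i)\<^sup>2) ** transpose V"
    using psd_sqrt_spectral by metis
  show "psd (psd_sqrt X)" unfolding B by (intro psd_congruence psd_diag_matrix s)
  have "psd_sqrt X ** psd_sqrt X
      = V ** (diag_matrix s ** (transpose V ** V) ** diag_matrix s) ** transpose V"
    unfolding B by (simp add: matrix_mul_assoc)
  then show "psd_sqrt X ** psd_sqrt X = X"
    using V by (simp add: X orthogonal_matrix diag_matrix_mult power2_eq_square)
qed

lemma transpose_psd_sqrt: "psd X \<Longrightarrow> transpose (psd_sqrt X) = psd_sqrt X"
  using psd_psd_sqrt psd_def by blast

lemma invertible_psd_sqrt:
  assumes "pd X"
  shows "invertible (psd_sqrt X)"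
proof -
  obtain Y where "X ** Y = mat 1"
    using pd_imp_invertible[OF assms] invertible_def by blast
  then have "psd_sqrt X ** (psd_sqrt X ** Y) = mat 1"
    using psd_sqrt_square[OF pd_imp_psd[OF assms]] by (simp add: matrix_mul_assoc)
  then show ?thesis using invertible_right_inverse by blast
qed

section \<open>Polar decomposition\<close>

lemma compact_orthogonal_matrices: "compact {U :: real^'k^'k. orthogonal_matrix U}"
proof -
  have "norm U \<le> sqrt (real CARD('k))" if "orthogonal_matrix U" for U :: "real^'k^'k"
  proof -
    have "U $ i \<bullet> U $ i = 1" for i
      using that unfolding orthogonal_matrix_orthonormal_rows
      by (simp add: row_def dot_square_norm)
    then have "U \<bullet> U = real CARD('k)" by (simp add: inner_vec_def[of U U])
    then show ?thesis by (simp add: norm_eq_sqrt_inner)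
  qed
  then have "bounded {U :: real^'k^'k. orthogonal_matrix U}"
    by (auto simp: bounded_iff)
  moreover have "continuous_on UNIV (\<lambda>U :: real^'k^'k. transpose U ** U)"
    unfolding transpose_def matrix_matrix_mult_def by (intro continuous_intros)
  then have "closed {U :: real^'k^'k. transpose U ** U = mat 1}"
    by (intro closed_Collect_eq continuous_on_const)
  ultimately show ?thesis
    unfolding orthogonal_matrix by (simp add: compact_eq_bounded_closed)
qed

text \<open>The rank-one matrix \<open>u w\<^sup>T\<close>.\<close>

definition outer :: "real^'m \<Rightarrow> real^'n \<Rightarrow> real^'n^'m" where
  "outer u w = (\<chi> i j. u $ i * w $ j)"

lemma outer_mult_vec: "outer u w *v x = (w \<bullet> x) *\<^sub>R u"
  by (simp add: outer_def matrix_vector_mult_def inner_vec_def vec_eq_iff sum_distrib_left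
      mult.assoc mult.commute mult.left_commute)

lemma trace_mult_outer: "trace (M ** outer u w) = w \<bullet> (M *v u)" for M :: "real^'k^'k"
  by (simp add: trace_def outer_def matrix_matrix_mult_def matrix_vector_mult_def inner_vec_def
      sum_distrib_left mult.commute mult.left_commute)

lemma orthogonal_matrix_normI:
  fixes R :: "real^'k^'k"
  assumes "\<And>x. (R *v x) \<bullet> (R *v x) = x \<bullet> x"
  shows "orthogonal_matrix R"
proof -
  have "orthogonal_transformation ((*v) R)"
    using assms by (simp add: orthogonal_transformation norm_eq_sqrt_inner)
  then show ?thesis by (simp add: orthogonal_transformation_matrix)
qed

lemma trace_scaleR: "trace (c *\<^sub>R A) = c * trace A" for A :: "real^'k^'k"
  by (simp add: trace_def sum_distrib_left)

text \<open>A maximiser \<open>W\<close> of \<open>trace (N W)\<close> over the compact orthogonal group makes \<open>M = N W\<close> positive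
  semi-definite: comparing with the reflection along a unit vector \<open>u\<close> gives \<open>0 \<le> u\<^sup>T M u\<close>, and
  comparing with rotations in coordinate planes gives symmetry.\<close>

theorem polar_decomposition:
  fixes N :: "real^'k^'k"
  obtains W where "orthogonal_matrix W" "psd_sqrt (N ** transpose N) = N ** W"
proof -
  let ?O = "{U :: real^'k^'k. orthogonal_matrix U}"
  have "continuous_on ?O (\<lambda>U. trace (N ** U))"
    unfolding trace_def matrix_matrix_mult_def by (intro continuous_intros)
  moreover have "?O \<noteq> {}" using orthogonal_matrix_id by blast
  ultimately obtain W where W: "orthogonal_matrix W"
    and max: "\<And>U. orthogonal_matrix U \<Longrightarrow> trace (N ** U) \<le> trace (N ** W)"
    using continuous_attains_sup[OF compact_orthogonal_matrices] by (metis mem_Collect_eq)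
  define M where "M = N ** W"
  have maxM: "trace (M ** R) \<le> trace M" if "orthogonal_matrix R" for R
    using max[OF orthogonal_matrix_mul[OF W that]] by (simp add: M_def matrix_mul_assoc)
  have unit: "0 \<le> u \<bullet> (M *v u)" if u: "u \<bullet> u = 1" for u
  proof -
    define R where "R = mat 1 - 2 *\<^sub>R outer u u"
    have Rx: "R *v x = x - (2 * (u \<bullet> x)) *\<^sub>R u" for x
      by (simp add: R_def matrix_vector_mult_diff_rdistrib scaleR_matrix_vector_assoc[symmetric] outer_mult_vec)
    have "orthogonal_matrix R"
      by (rule orthogonal_matrix_normI)
        (simp add: Rx inner_diff_left inner_diff_right u inner_commute algebra_simps)
    from maxM[OF this] show ?thesis
      by (simp add: R_def matrix_diff_ldistrib matrix_mult_scaleR_right trace_sub trace_scaleR trace_mult_outer)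
  qed
  have pos: "0 \<le> v \<bullet> (M *v v)" for v
  proof (cases "v = 0")
    case False
    have "(inverse (norm v) *\<^sub>R v) \<bullet> (inverse (norm v) *\<^sub>R v) = 1"
      using False by (simp add: dot_square_norm power2_eq_square field_simps)
    from unit[OF this] show ?thesis
      using False by (simp add: matrix_vector_mult_scaleR zero_le_mult_iff)
  qed simp
  have sym: "M $ i $ j = M $ j $ i" for i j
  proof (cases "i = j")
    case False
    let ?a = "axis i 1 :: real^'k" and ?b = "axis j 1 :: real^'k"
    have orth: "?a \<bullet> ?a = 1" "?b \<bullet> ?b = 1" "?a \<bullet> ?b = 0" "?b \<bullet> ?a = 0"
      using False by (auto simp: inner_axis_axis)
    have rot: "(c - 1) * (M $ i $ i + M $ j $ j) + s * (M $ i $ j - M $ j $ i) \<le> 0"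
      if cs: "c\<^sup>2 + s\<^sup>2 = 1" for c s :: real
    proof -
      define R where "R = mat 1 + (c - 1) *\<^sub>R (outer ?a ?a + outer ?b ?b)
        + s *\<^sub>R (outer ?b ?a - outer ?a ?b)"
      have Rx: "R *v x = x + ((c - 1) * (?a \<bullet> x) - s * (?b \<bullet> x)) *\<^sub>R ?a
          + ((c - 1) * (?b \<bullet> x) + s * (?a \<bullet> x)) *\<^sub>R ?b" for x
        by (simp add: R_def matrix_vector_mult_diff_rdistrib matrix_vector_mult_add_rdistrib
            scaleR_matrix_vector_assoc[symmetric] outer_mult_vec algebra_simps)
      have "(R *v x) \<bullet> (R *v x) = x \<bullet> x" for x
      proof -
        have "(R *v x) \<bullet> (R *v x) = x \<bullet> x + (c\<^sup>2 + s\<^sup>2 - 1) * ((?a \<bullet> x)\<^sup>2 + (?b \<bullet> x)\<^sup>2)"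
          unfolding Rx by (simp only: inner_add_left inner_add_right inner_scaleR_left
              inner_scaleR_right orth inner_commute[of x ?a] inner_commute[of x ?b])
            (simp add: power2_eq_square algebra_simps)
        then show ?thesis using cs by simp
      qed
      then have "orthogonal_matrix R" by (rule orthogonal_matrix_normI)
      from maxM[OF this] show ?thesis
        by (simp add: R_def matrix_diff_ldistrib matrix_add_ldistrib matrix_mult_scaleR_right trace_sub
            trace_add trace_scaleR trace_mult_outer axis_dot_mult_axis algebra_simps)
    qed
    have "t * (2 * (M $ i $ j - M $ j $ i)) + t\<^sup>2 * - (2 * (M $ i $ i + M $ j $ j)) \<le> 0" for t :: real
    proof -
      \<comment> \<open>rational parametrisation of the circle\<close>
      define q where "q = 1 + t\<^sup>2"
      have q: "0 < q" by (simp add: q_def add_pos_nonneg)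
      have "(1 - t\<^sup>2)\<^sup>2 + (2 * t)\<^sup>2 = q\<^sup>2"
        by (simp add: q_def power2_eq_square algebra_simps)
      then have "((1 - t\<^sup>2) / q)\<^sup>2 + (2 * t / q)\<^sup>2 = 1"
        using q by (simp add: power_divide add_divide_distrib[symmetric])
      from rot[OF this]
      have "q * (((1 - t\<^sup>2) / q - 1) * (M $ i $ i + M $ j $ j) + 2 * t / q * (M $ i $ j - M $ j $ i)) \<le> 0"
        using q by (simp add: mult_le_0_iff)
      also have "q * (((1 - t\<^sup>2) / q - 1) * (M $ i $ i + M $ j $ j) + 2 * t / q * (M $ i $ j - M $ j $ i))
        = (1 - t\<^sup>2 - q) * (M $ i $ i + M $ j $ j) + 2 * t * (M $ i $ j - M $ j $ i)"
        using q by (simp add: field_simps)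
      finally show ?thesis by (simp add: q_def algebra_simps)
    qed
    from linear_term_zero_of_nonpos[OF this] show ?thesis by simp
  qed simp
  then have tM: "transpose M = M" by (simp add: transpose_def vec_eq_iff)
  have "psd M" using tM pos by (simp add: psd_def)
  moreover have "M ** M = N ** (W ** transpose W) ** transpose N"
    by (metis M_def matrix_mul_assoc matrix_transpose_mul tM)
  then have "M ** M = N ** transpose N"
    using W by (simp add: orthogonal_matrix_def)
  ultimately have "psd_sqrt (N ** transpose N) = N ** W"
    unfolding M_def by (rule psd_sqrt_unique)
  with W that show thesis by blast
qed

section \<open>The standard Gaussian law\<close>

lemma nn_integral_lborel_translate:
  fixes c :: "'a::euclidean_space"
  assumes [measurable]: "f \<in> borel_measurable borel"
  shows "(\<integral>\<^sup>+x. f (c + x) \<partial>lborel) = (\<integral>\<^sup>+x. f x \<partial>lborel)"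
proof -
  have "(\<integral>\<^sup>+x. f x \<partial>lborel) = (\<integral>\<^sup>+x. f x \<partial>distr lborel borel ((+) c))"
    by (simp add: lborel_distr_plus)
  then show ?thesis by (simp add: nn_integral_distr)
qed

text \<open>The image \<open>\<mu>\<close> of Lebesgue measure \<open>\<lambda>\<close> under an orthogonal map is translation invariant and
  agrees with \<open>\<lambda>\<close> on the unit ball \<open>B\<close>. Evaluating the integral of \<open>1\<^sub>B(y) 1\<^sub>A(T x + y)\<close> in both
  orders gives \<open>\<lambda>(B) \<mu>(A) = \<lambda>(B) \<lambda>(A)\<close>.\<close>

lemma lborel_orthogonal_invariant:
  fixes T :: "'a::euclidean_space \<Rightarrow> 'a"
  assumes T: "orthogonal_transformation T"
  shows "distr lborel borel T = lborel"
proof (rule measure_eqI)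
  fix A assume "A \<in> sets (distr lborel borel T)"
  then have A[measurable]: "A \<in> sets borel" by simp
  have lin: "linear T" using T by (rule orthogonal_transformation_linear)
  then have [measurable]: "T \<in> borel_measurable borel"
    by (intro borel_measurable_continuous_onI linear_continuous_on linear_conv_bounded_linear[THEN iffD1])
  define T' where "T' = inv T"
  have TT': "T (T' y) = y" for y
    unfolding T'_def using orthogonal_transformation_surj[OF T] by (rule surj_f_inv_f)
  define B where "B = ball (0::'a) 1"
  have [measurable]: "B \<in> sets borel" by (simp add: B_def)
  have B_pos: "emeasure lborel B \<noteq> 0"
    using content_ball_pos[of 1 "0::'a"] by (auto simp: B_def measure_def)
  have B_fin: "emeasure lborel B \<noteq> \<infinity>"
    using emeasure_bounded_finite[of B] by (simp add: B_def less_top)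
  let ?f = "\<lambda>x y. indicator B y * indicator A (T x + y) :: ennreal"
  have "(\<integral>\<^sup>+y. \<integral>\<^sup>+x. ?f x y \<partial>lborel \<partial>lborel)
      = (\<integral>\<^sup>+y. indicator B y * (\<integral>\<^sup>+x. indicator A (T x) \<partial>lborel) \<partial>lborel)"
  proof (rule nn_integral_cong)
    fix y
    have "(\<integral>\<^sup>+x. indicator A (T x + y) \<partial>lborel) = (\<integral>\<^sup>+x. indicator A (T (T' y + x)) \<partial>lborel)"
      using lin by (simp add: linear_add TT' add.commute)
    also have "\<dots> = (\<integral>\<^sup>+x. indicator A (T x) \<partial>lborel)"
      by (rule nn_integral_lborel_translate) measurable
    finally show "(\<integral>\<^sup>+x. ?f x y \<partial>lborel) = indicator B y * (\<integral>\<^sup>+x. indicator A (T x) \<partial>lborel)"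
      by (subst nn_integral_cmult) auto
  qed
  also have "\<dots> = emeasure lborel B * emeasure (distr lborel borel T) A"
  proof -
    have "(\<integral>\<^sup>+x. indicator A (T x) \<partial>lborel) = emeasure (distr lborel borel T) A"
      using nn_integral_distr[of T lborel borel "indicator A"] by (simp add: nn_integral_indicator)
    then show ?thesis by (simp add: nn_integral_multc)
  qed
  finally have 1: "(\<integral>\<^sup>+y. \<integral>\<^sup>+x. ?f x y \<partial>lborel \<partial>lborel)
      = emeasure lborel B * emeasure (distr lborel borel T) A" .
  have "(\<integral>\<^sup>+x. \<integral>\<^sup>+y. ?f x y \<partial>lborel \<partial>lborel)
      = (\<integral>\<^sup>+x. \<integral>\<^sup>+y. indicator A y * indicator B (T' y - x) \<partial>lborel \<partial>lborel)"
  proof (rule nn_integral_cong)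
    fix x
    have "indicator B (- T x + y) = (indicator B (T' y - x) :: ennreal)" for y
    proof -
      have "T (T' y - x) = - T x + y" using lin by (simp add: linear_diff TT')
      then have "norm (- T x + y) = norm (T' y - x)"
        using T by (metis orthogonal_transformation_norm)
      then show ?thesis by (simp add: B_def indicator_def)
    qed
    then have "(\<integral>\<^sup>+y. indicator A y * indicator B (T' y - x) \<partial>lborel)
        = (\<integral>\<^sup>+y. indicator A y * indicator B (- T x + y) \<partial>lborel)"
      by simp
    also have "\<dots> = (\<integral>\<^sup>+y. ?f x y \<partial>lborel)"
      by (subst nn_integral_lborel_translate[symmetric, of _ "T x"]) (auto simp: mult.commute)
    finally show "(\<integral>\<^sup>+y. ?f x y \<partial>lborel) = (\<integral>\<^sup>+y. indicator A y * indicator B (T' y - x) \<partial>lborel)"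
      by simp
  qed
  also have "\<dots> = (\<integral>\<^sup>+y. \<integral>\<^sup>+x. indicator A y * indicator B (T' y - x) \<partial>lborel \<partial>lborel)"
  proof (rule lborel_pair.Fubini')
    have "orthogonal_transformation T'"
      unfolding T'_def using T by (rule orthogonal_transformation_inv)
    then have "linear T'" by (rule orthogonal_transformation_linear)
    then have [measurable]: "T' \<in> borel_measurable borel"
      by (intro borel_measurable_continuous_onI linear_continuous_on linear_conv_bounded_linear[THEN iffD1])
    show "(\<lambda>(y, x). indicator A y * indicator B (T' y - x) :: ennreal)
        \<in> borel_measurable (lborel \<Otimes>\<^sub>M lborel)"
      by measurable
  qed
  also have "\<dots> = (\<integral>\<^sup>+y. indicator A y * emeasure lborel B \<partial>lborel)"
  proof (rule nn_integral_cong)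
    fix y
    have "indicator B (T' y - x) = (indicator B (- T' y + x) :: ennreal)" for x
      by (simp add: B_def indicator_def norm_minus_commute)
    then have "(\<integral>\<^sup>+x. indicator B (T' y - x) \<partial>lborel) = (\<integral>\<^sup>+x. indicator B (- T' y + x) \<partial>lborel)"
      by (simp only:)
    also have "\<dots> = (\<integral>\<^sup>+x. indicator B x \<partial>lborel :: ennreal)"
      by (rule nn_integral_lborel_translate) measurable
    finally have e: "(\<integral>\<^sup>+x. indicator B (T' y - x) \<partial>lborel) = emeasure lborel B"
      by simp
    show "(\<integral>\<^sup>+x. indicator A y * indicator B (T' y - x) \<partial>lborel) = indicator A y * emeasure lborel B"
      by (subst nn_integral_cmult) (auto simp: e)
  qed
  also have "\<dots> = emeasure lborel B * emeasure lborel A"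
    by (simp add: nn_integral_multc mult.commute)
  finally have 2: "(\<integral>\<^sup>+x. \<integral>\<^sup>+y. ?f x y \<partial>lborel \<partial>lborel) = emeasure lborel B * emeasure lborel A" .
  have "(\<integral>\<^sup>+x. \<integral>\<^sup>+y. ?f x y \<partial>lborel \<partial>lborel) = (\<integral>\<^sup>+y. \<integral>\<^sup>+x. ?f x y \<partial>lborel \<partial>lborel)"
    by (rule lborel_pair.Fubini') measurable
  then have "emeasure lborel B * emeasure lborel A = emeasure lborel B * emeasure (distr lborel borel T) A"
    using 1 2 by simp
  then show "emeasure (distr lborel borel T) A = emeasure lborel A"
    using B_pos B_fin by (simp add: ennreal_mult_cancel_left)
qed simp

lemma borel_measurable_mult_vec [measurable (raw)]:
  fixes A :: "real^'n^'m"
  assumes [measurable]: "f \<in> borel_measurable M"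
  shows "(\<lambda>x. A *v f x) \<in> borel_measurable M"
proof -
  have "(*v) A \<in> borel_measurable borel"
    by (intro borel_measurable_continuous_onI continuous_intros)
  from measurable_compose[OF assms this] show ?thesis .
qed

text \<open>The density of the standard Gaussian law with respect to Lebesgue measure.\<close>

definition std_gaussian_density :: "real^'k \<Rightarrow> ennreal" where
  "std_gaussian_density z = (\<Prod>i\<in>UNIV. ennreal (normal_density 0 1 (z $ i)))"

lemma std_gaussian_eq: "std_gaussian = density lborel std_gaussian_density"
  by (simp add: std_gaussian_def std_gaussian_density_def[abs_def])

lemma std_gaussian_density_measurable [measurable]: "std_gaussian_density \<in> borel_measurable borel"
  unfolding std_gaussian_density_def by measurable

lemma std_gaussian_density_radial:
  "std_gaussian_density z = ennreal ((1 / sqrt (2 * pi)) ^ CARD('k) * exp (- (z \<bullet> z) / 2))"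
  for z :: "real^'k"
proof -
  have "(\<Prod>i\<in>UNIV. normal_density 0 1 (z $ i))
      = (1 / sqrt (2 * pi)) ^ CARD('k) * exp (\<Sum>i\<in>UNIV. - (z $ i)\<^sup>2 / 2)"
    unfolding normal_density_def by (simp add: prod.distrib exp_sum prod_dividef power_divide)
  also have "(\<Sum>i\<in>UNIV. - (z $ i)\<^sup>2 / 2) = - (z \<bullet> z) / 2"
    by (simp add: inner_vec_def sum_negf sum_divide_distrib power2_eq_square)
  finally show ?thesis
    unfolding std_gaussian_density_def by (subst prod_ennreal) auto
qed

lemma prod_Basis_vec: "(\<Prod>b\<in>Basis. g b) = (\<Prod>i\<in>UNIV. g (axis i 1))"
  for g :: "real^'k \<Rightarrow> 'b::comm_monoid_mult"
proof -
  have B: "(Basis :: (real^'k) set) = range (\<lambda>i. axis i 1)" by (auto simp: Basis_vec_def)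
  have inj: "inj (\<lambda>i::'k. axis i (1::real))" by (auto simp: inj_on_def axis_eq_axis)
  show ?thesis unfolding B by (subst prod.reindex[OF inj]) simp
qed

lemma nn_integral_prod_coordinates:
  fixes f :: "'k::finite \<Rightarrow> real \<Rightarrow> ennreal"
  assumes [measurable]: "\<And>i. f i \<in> borel_measurable borel"
  shows "(\<integral>\<^sup>+z. (\<Prod>i\<in>UNIV. f i (z $ i)) \<partial>lborel) = (\<Prod>i\<in>UNIV. \<integral>\<^sup>+x. f i x \<partial>lborel)"
proof -
  define F where "F b = f (SOME i. b = axis i 1)" for b :: "real^'k"
  have F: "F (axis i 1) = f i" for i by (simp add: F_def axis_eq_axis)
  have "(\<integral>\<^sup>+z. (\<Prod>b\<in>Basis. F b (z \<bullet> b)) \<partial>lborel) = (\<Prod>b\<in>Basis. \<integral>\<^sup>+x. F b x \<partial>lborel)"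
    by (rule nn_integral_lborel_prod) (auto simp: F_def)
  then show ?thesis by (simp add: prod_Basis_vec F inner_axis)
qed

lemma sets_std_gaussian [measurable_cong, simp]: "sets std_gaussian = sets borel"
  and space_std_gaussian [simp]: "space std_gaussian = UNIV"
  by (simp_all add: std_gaussian_def)

lemma nn_integral_std_normal_density: "(\<integral>\<^sup>+x. ennreal (normal_density 0 1 x) \<partial>lborel) = 1"
  using prob_space.emeasure_space_1[OF prob_space_normal_density[of 1 0]]
  by (simp add: emeasure_density)

lemma prob_space_std_gaussian: "prob_space std_gaussian"
  using nn_integral_prod_coordinates[of "\<lambda>i x. ennreal (normal_density 0 1 x)"]
  by (intro prob_spaceI)
    (simp add: std_gaussian_eq emeasure_density std_gaussian_density_def nn_integral_std_normal_density)

lemma distr_std_gaussian_orthogonal: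
  fixes U :: "real^'k^'k"
  assumes U: "orthogonal_matrix U"
  shows "distr std_gaussian borel ((*v) U) = std_gaussian"
proof -
  have T: "orthogonal_transformation ((*v) U)"
    using U by (simp add: orthogonal_transformation_matrix)
  have "std_gaussian_density (U *v z) = std_gaussian_density z" for z
    using T by (simp add: std_gaussian_density_radial orthogonal_transformation_def)
  then have "distr std_gaussian borel ((*v) U)
      = distr (density lborel (\<lambda>z. std_gaussian_density (U *v z))) borel ((*v) U)"
    by (simp add: std_gaussian_eq)
  also have "\<dots> = density (distr lborel borel ((*v) U)) std_gaussian_density"
    by (rule density_distr[symmetric]) measurable
  finally show ?thesis by (simp add: lborel_orthogonal_invariant[OF T] std_gaussian_eq)
qed

lemma stack_nth [simp]: "stack a b $ Inl i = a $ i" "stack a b $ Inr j = b $ j"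
  by (simp_all add: stack_def)

lemma sum_UNIV_Plus: "(\<Sum>i\<in>UNIV. f i) = (\<Sum>i\<in>UNIV. f (Inl i)) + (\<Sum>j\<in>UNIV. f (Inr j))"
  for f :: "'a::finite + 'b::finite \<Rightarrow> 'c::comm_monoid_add"
  by (simp add: UNIV_Plus_UNIV[symmetric] sum.Plus del: UNIV_Plus_UNIV)

lemma prod_UNIV_Plus: "(\<Prod>i\<in>UNIV. f i) = (\<Prod>i\<in>UNIV. f (Inl i)) * (\<Prod>j\<in>UNIV. f (Inr j))"
  for f :: "'a::finite + 'b::finite \<Rightarrow> 'c::comm_monoid_mult"
  by (simp add: UNIV_Plus_UNIV[symmetric] prod.Plus del: UNIV_Plus_UNIV)

lemma stack_inner: "stack a b \<bullet> stack c d = a \<bullet> c + b \<bullet> d"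
  by (simp add: inner_vec_def sum_UNIV_Plus)

lemma stack_add: "stack a b + stack c d = stack (a + c) (b + d)"
  and stack_diff: "stack a b - stack c d = stack (a - c) (b - d)"
  and stack_scaleR: "r *\<^sub>R stack a b = stack (r *\<^sub>R a) (r *\<^sub>R b)"
  by (simp_all add: vec_eq_iff stack_def split: sum.split)

lemma linear_stack: "linear (\<lambda>(a, b). stack a b)"
  by (rule linearI) (auto simp: stack_add stack_scaleR)

lemma stack_measurable [measurable]: "(\<lambda>p. stack (fst p) (snd p)) \<in> borel_measurable borel"
  using linear_stack
  by (intro borel_measurable_continuous_onI linear_continuous_on linear_conv_bounded_linear[THEN iffD1])
    (simp add: case_prod_beta')

lemma borel_measurable_stack [measurable (raw)]:
  assumes [measurable]: "f \<in> borel_measurable M" "g \<in> borel_measurable M"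
  shows "(\<lambda>x. stack (f x) (g x)) \<in> borel_measurable M"
proof -
  have "(\<lambda>x. (f x, g x)) \<in> M \<rightarrow>\<^sub>M borel \<Otimes>\<^sub>M borel" by measurable
  then have "(\<lambda>x. (f x, g x)) \<in> M \<rightarrow>\<^sub>M borel" by (simp add: borel_prod)
  from measurable_compose[OF this stack_measurable] show ?thesis by simp
qed

text \<open>The two halves of a vector indexed by a sum type.\<close>

definition upper :: "real^('n::finite + 'm::finite) \<Rightarrow> real^'n" where "upper z = (\<chi> i. z $ Inl i)"
definition lower :: "real^('n::finite + 'm::finite) \<Rightarrow> real^'m" where "lower z = (\<chi> j. z $ Inr j)"

lemma upper_stack [simp]: "upper (stack a b) = a" and lower_stack [simp]: "lower (stack a b) = b"
  by (simp_all add: upper_def lower_def)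

lemma stack_upper_lower [simp]: "stack (upper z) (lower z) = z"
  by (simp add: vec_eq_iff upper_def lower_def stack_def split: sum.split)

lemma upper_measurable [measurable]: "upper \<in> borel_measurable borel"
  and lower_measurable [measurable]: "lower \<in> borel_measurable borel"
  unfolding upper_def[abs_def] lower_def[abs_def]
  by (auto intro!: borel_measurable_continuous_onI continuous_intros)

lemma distr_lborel_stack:
  "distr (lborel \<Otimes>\<^sub>M lborel) borel (\<lambda>p. stack (fst p) (snd p)) = (lborel :: (real^('n::finite + 'm::finite)) measure)"
proof (rule lborel_eqI[symmetric])
  fix l u :: "real^('n::finite + 'm::finite)"
  assume le: "\<And>b. b \<in> Basis \<Longrightarrow> l \<bullet> b \<le> u \<bullet> b"
  have lei: "l $ i \<le> u $ i" for i
    using le[of "axis i 1"] by (simp add: inner_axis)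
  have "(\<lambda>p. stack (fst p) (snd p)) -` box l u = box (upper l) (upper u) \<times> box (lower l) (lower u)"
    by (auto simp: mem_box_cart upper_def lower_def stack_def split: sum.splits)
  then have "emeasure (distr (lborel \<Otimes>\<^sub>M lborel) borel (\<lambda>p. stack (fst p) (snd p))) (box l u)
      = emeasure lborel (box (upper l) (upper u)) * emeasure lborel (box (lower l) (lower u))"
    by (subst emeasure_distr)
      (auto simp: space_pair_measure lborel.emeasure_pair_measure_Times[symmetric] lborel_prod)
  also have "\<dots> = ennreal (\<Prod>b\<in>Basis. (upper u - upper l) \<bullet> b) * ennreal (\<Prod>b\<in>Basis. (lower u - lower l) \<bullet> b)"
    by (subst (1 2) emeasure_lborel_box)
      (auto simp: Basis_vec_def inner_axis upper_def lower_def lei)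
  also have "\<dots> = ennreal (\<Prod>b\<in>Basis. (u - l) \<bullet> b)"
    by (subst ennreal_mult[symmetric])
      (auto simp: prod_Basis_vec inner_axis prod_UNIV_Plus upper_def lower_def lei intro!: prod_nonneg)
  finally show "emeasure (distr (lborel \<Otimes>\<^sub>M lborel) borel (\<lambda>p. stack (fst p) (snd p))) (box l u)
      = ennreal (\<Prod>b\<in>Basis. (u - l) \<bullet> b)" .
qed simp

lemma distr_std_gaussian_stack:
  "distr (std_gaussian \<Otimes>\<^sub>M std_gaussian) borel (\<lambda>p. stack (fst p) (snd p))
    = (std_gaussian :: (real^('n::finite + 'm::finite)) measure)"
proof -
  let ?s = "\<lambda>p :: (real^'n) \<times> (real^'m). stack (fst p) (snd p)"
  interpret s: prob_space "std_gaussian :: (real^'m) measure" by (rule prob_space_std_gaussian)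
  have "sigma_finite_measure (density lborel std_gaussian_density :: (real^'m) measure)"
    using s.sigma_finite_measure_axioms by (simp add: std_gaussian_eq)
  then have "std_gaussian \<Otimes>\<^sub>M std_gaussian = density (lborel \<Otimes>\<^sub>M lborel)
      (\<lambda>(x :: real^'n, y :: real^'m). std_gaussian_density x * std_gaussian_density y)"
    unfolding std_gaussian_eq
    by (intro pair_measure_density) (auto intro: lborel.sigma_finite_measure_axioms)
  also have "(\<lambda>(x :: real^'n, y :: real^'m). std_gaussian_density x * std_gaussian_density y)
      = (\<lambda>p. std_gaussian_density (?s p))"
    by (auto simp: std_gaussian_density_def prod_UNIV_Plus)
  finally have "distr (std_gaussian \<Otimes>\<^sub>M std_gaussian) borel ?s
      = density (distr (lborel \<Otimes>\<^sub>M lborel) borel ?s) std_gaussian_density"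
    by (subst density_distr) (auto simp: lborel_prod)
  then show ?thesis by (simp add: distr_lborel_stack std_gaussian_eq)
qed

section \<open>Second moments\<close>

text \<open>\<open>G\<close> is the matrix of (uncentred) second moments of \<open>X\<close>, all of which are finite.\<close>

definition has_second_moment :: "'w measure \<Rightarrow> ('w \<Rightarrow> real^'k) \<Rightarrow> real^'k^'k \<Rightarrow> bool" where
  "has_second_moment M X G \<longleftrightarrow> X \<in> borel_measurable M \<and>
     (\<forall>u v. has_bochner_integral M (\<lambda>\<omega>. (u \<bullet> X \<omega>) * (v \<bullet> X \<omega>)) (u \<bullet> (G *v v)))"

lemma has_second_moment_measurable: "has_second_moment M X G \<Longrightarrow> X \<in> borel_measurable M"
  by (simp add: has_second_moment_def)

lemma has_second_momentD:
  "has_second_moment M X G \<Longrightarrow>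
    has_bochner_integral M (\<lambda>\<omega>. (u \<bullet> X \<omega>) * (v \<bullet> X \<omega>)) (u \<bullet> (G *v v))"
  by (simp add: has_second_moment_def)

lemma has_second_moment_mult:
  fixes L :: "real^'k^'l"
  assumes "has_second_moment M X G"
  shows "has_second_moment M (\<lambda>\<omega>. L *v X \<omega>) (L ** G ** transpose L)"
proof -
  have [measurable]: "X \<in> borel_measurable M" using assms by (rule has_second_moment_measurable)
  have "has_bochner_integral M (\<lambda>\<omega>. ((transpose L *v u) \<bullet> X \<omega>) * ((transpose L *v v) \<bullet> X \<omega>))
      ((transpose L *v u) \<bullet> (G *v (transpose L *v v)))" for u v
    using assms unfolding has_second_moment_def by blast
  then show ?thesis
    by (simp add: has_second_moment_def dot_mult_transpose[of _ L] matrix_vector_mul_assoc[symmetric]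
        del: transpose_matrix_vector)
qed

lemma has_second_moment_distr:
  assumes "f \<in> M \<rightarrow>\<^sub>M N" "X \<in> borel_measurable N"
  shows "has_second_moment (distr M N f) X G \<longleftrightarrow> has_second_moment M (\<lambda>\<omega>. X (f \<omega>)) G"
  using assms unfolding has_second_moment_def
  by (simp add: has_bochner_integral_iff integrable_distr_eq integral_distr)

lemma has_second_moment_quadratic_form:
  assumes "has_second_moment M X G"
  shows "has_bochner_integral M (\<lambda>\<omega>. X \<omega> \<bullet> (K *v X \<omega>)) (trace (K ** G))"
proof -
  have "has_bochner_integral M (\<lambda>\<omega>. \<Sum>i\<in>UNIV. ((transpose K *v axis i 1) \<bullet> X \<omega>) * (axis i 1 \<bullet> X \<omega>))
      (\<Sum>i\<in>UNIV. (transpose K *v axis i 1) \<bullet> (G *v axis i 1))"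
    using assms unfolding has_second_moment_def by (intro has_bochner_integral_sum) blast
  moreover have "(\<Sum>i\<in>UNIV. ((transpose K *v axis i 1) \<bullet> x) * (axis i 1 \<bullet> x)) = x \<bullet> (K *v x)" for x
    by (simp only: dot_mult_transpose[symmetric])
      (simp add: inner_vec_def[of x] inner_axis' mult.commute)
  moreover have "(\<Sum>i\<in>UNIV. (transpose K *v axis i 1) \<bullet> (G *v axis i 1)) = trace (K ** G)"
    by (simp only: dot_mult_transpose[symmetric] trace_as_sum_dot matrix_vector_mul_assoc)
  ultimately show ?thesis by simp
qed

lemma has_second_moment_norm_square:
  assumes "has_second_moment M X G"
  shows "has_bochner_integral M (\<lambda>\<omega>. X \<omega> \<bullet> X \<omega>) (trace G)"
  using has_second_moment_quadratic_form[OF assms, of "mat 1"] by simp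

lemma abs_mult_le_sum_squares: "\<bar>a * b\<bar> \<le> a * a + b * b" for a b :: real
proof -
  have "2 * (\<bar>a\<bar> * \<bar>b\<bar>) \<le> a * a + b * b"
    using sum_squares_bound[of "\<bar>a\<bar>" "\<bar>b\<bar>"] by (simp add: power2_eq_square)
  moreover have "0 \<le> \<bar>a\<bar> * \<bar>b\<bar>" by simp
  ultimately show ?thesis unfolding abs_mult by linarith
qed

lemma has_second_moment_integrable_product:
  assumes X: "has_second_moment M X G" and Y: "has_second_moment M Y F"
  shows "integrable M (\<lambda>\<omega>. (u \<bullet> X \<omega>) * (v \<bullet> Y \<omega>))"
proof (rule Bochner_Integration.integrable_bound)
  have [measurable]: "X \<in> borel_measurable M" "Y \<in> borel_measurable M"
    using X Y by (auto intro: has_second_moment_measurable)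
  show "integrable M (\<lambda>\<omega>. (u \<bullet> X \<omega>) * (u \<bullet> X \<omega>) + (v \<bullet> Y \<omega>) * (v \<bullet> Y \<omega>))"
    using X Y unfolding has_second_moment_def by (auto simp: has_bochner_integral_iff)
  show "(\<lambda>\<omega>. (u \<bullet> X \<omega>) * (v \<bullet> Y \<omega>)) \<in> borel_measurable M" by measurable
  show "AE \<omega> in M. norm ((u \<bullet> X \<omega>) * (v \<bullet> Y \<omega>))
      \<le> norm ((u \<bullet> X \<omega>) * (u \<bullet> X \<omega>) + (v \<bullet> Y \<omega>) * (v \<bullet> Y \<omega>))"
    using abs_mult_le_sum_squares by (auto intro: order_trans[OF _ abs_ge_self])
qed

lemma has_second_moment_integrable_inner:
  fixes X Y :: "'w \<Rightarrow> real^'k"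
  assumes X: "has_second_moment M X G" and Y: "has_second_moment M Y F"
  shows "integrable M (\<lambda>\<omega>. X \<omega> \<bullet> Y \<omega>)"
proof -
  have "integrable M (\<lambda>\<omega>. \<Sum>i\<in>UNIV. (axis i 1 \<bullet> X \<omega>) * (axis i 1 \<bullet> Y \<omega>))"
    by (intro Bochner_Integration.integrable_sum has_second_moment_integrable_product[OF X Y])
  then show ?thesis by (simp add: inner_axis' inner_vec_def[of "X _"])
qed

lemma std_gaussian_coordinate_square:
  "has_bochner_integral std_gaussian (\<lambda>z :: real^'k. (z $ i)\<^sup>2) 1"
proof (rule has_bochner_integral_nn_integral)
  define f where "f j x = ennreal (normal_density 0 1 x) * (if j = i then ennreal (x\<^sup>2) else 1)"
    for j :: 'k and x :: real
  have f_other: "(\<integral>\<^sup>+x. f j x \<partial>lborel) = 1" for j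
  proof (cases "j = i")
    case True
    have "has_bochner_integral lborel (\<lambda>x. normal_density 0 1 x * x\<^sup>2) 1"
      using normal_moment_even[of 1 0 1] by simp
    then have "(\<integral>\<^sup>+x. ennreal (normal_density 0 1 x * x\<^sup>2) \<partial>lborel) = 1"
      by (subst nn_integral_eq_integral) (auto simp: has_bochner_integral_iff)
    with True show ?thesis by (simp add: f_def ennreal_mult)
  qed (simp add: f_def nn_integral_std_normal_density)
  have prod: "std_gaussian_density z * ennreal ((z $ i)\<^sup>2) = (\<Prod>j\<in>UNIV. f j (z $ j))" for z :: "real^'k"
    by (simp add: std_gaussian_density_def f_def prod.distrib)
  have "(\<integral>\<^sup>+z. ennreal ((z $ i)\<^sup>2) \<partial>std_gaussian)
      = (\<integral>\<^sup>+z. std_gaussian_density z * ennreal ((z $ i)\<^sup>2) \<partial>(lborel :: (real^'k) measure))"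
    unfolding std_gaussian_eq by (subst nn_integral_density) auto
  also have "\<dots> = 1"
    unfolding prod by (subst nn_integral_prod_coordinates) (auto simp: f_def[abs_def] f_other[unfolded f_def])
  finally show "(\<integral>\<^sup>+z. ennreal ((z $ i)\<^sup>2) \<partial>(std_gaussian :: (real^'k) measure)) = ennreal 1" by simp
qed auto

text \<open>Distinct coordinates are uncorrelated because the law is invariant under the reflection that
  changes the sign of one of them.\<close>

lemma std_gaussian_second_moment: "has_second_moment std_gaussian (\<lambda>z :: real^'k. z) (mat 1)"
proof -
  have int: "integrable std_gaussian (\<lambda>z :: real^'k. z $ i * z $ j)" for i j
  proof (rule Bochner_Integration.integrable_bound)
    show "integrable std_gaussian (\<lambda>z :: real^'k. (z $ i)\<^sup>2 + (z $ j)\<^sup>2)"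
      using std_gaussian_coordinate_square
      by (intro Bochner_Integration.integrable_add) (auto simp: has_bochner_integral_iff)
    show "AE z :: real^'k in std_gaussian. norm (z $ i * z $ j) \<le> norm ((z $ i)\<^sup>2 + (z $ j)\<^sup>2)"
      using abs_mult_le_sum_squares by (auto simp: power2_eq_square intro: order_trans[OF _ abs_ge_self])
  qed simp
  have off: "(\<integral>z. z $ i * z $ j \<partial>(std_gaussian :: (real^'k) measure)) = 0" if "i \<noteq> j" for i j
  proof -
    define U :: "real^'k^'k" where "U = diag_matrix (\<lambda>k. if k = i then -1 else 1)"
    have "orthogonal_matrix U"
      unfolding orthogonal_matrix U_def transpose_diag_matrix diag_matrix_mult
      by (simp add: diag_matrix_def mat_def vec_eq_iff)
    then have "(\<integral>z. z $ i * z $ j \<partial>(std_gaussian :: (real^'k) measure))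
        = (\<integral>z. z $ i * z $ j \<partial>distr std_gaussian borel ((*v) U))"
      by (simp add: distr_std_gaussian_orthogonal)
    also have "\<dots> = (\<integral>z. (U *v z) $ i * (U *v z) $ j \<partial>std_gaussian)"
      by (rule integral_distr) auto
    also have "\<dots> = - (\<integral>z. z $ i * z $ j \<partial>(std_gaussian :: (real^'k) measure))"
      using that by (simp add: U_def diag_matrix_mult_vec)
    finally show ?thesis by simp
  qed
  have ij: "has_bochner_integral std_gaussian (\<lambda>z :: real^'k. z $ i * z $ j) (if i = j then 1 else 0)" for i j
    using int[of i j] off[of i j] std_gaussian_coordinate_square[of i]
    by (auto simp: has_bochner_integral_iff power2_eq_square)
  have "has_bochner_integral std_gaussian (\<lambda>z :: real^'k. \<Sum>i\<in>UNIV. \<Sum>j\<in>UNIV. (u $ i * v $ j) * (z $ i * z $ j))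
      (\<Sum>i\<in>UNIV. \<Sum>j\<in>UNIV. (u $ i * v $ j) * (if i = j then 1 else 0))" for u v
    by (intro has_bochner_integral_sum has_bochner_integral_mult_right ij)
  moreover have "(\<Sum>i\<in>UNIV. \<Sum>j\<in>UNIV. (u $ i * v $ j) * (z $ i * z $ j)) = (u \<bullet> z) * (v \<bullet> z)"
    for u v z :: "real^'k"
    by (simp add: inner_vec_def sum_product mult.assoc mult.left_commute)
  moreover have "(\<Sum>i\<in>UNIV. \<Sum>j\<in>UNIV. (u $ i * v $ j) * (if i = j then 1 else 0)) = u \<bullet> v"
    for u v :: "real^'k"
    by (simp add: inner_vec_def if_distrib cong: if_cong)
  ultimately show ?thesis
    by (simp add: has_second_moment_def)
qed

lemma std_gaussian_mean: "has_bochner_integral std_gaussian (\<lambda>z :: real^'k. u \<bullet> z) 0"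
proof -
  interpret prob_space "std_gaussian :: (real^'k) measure" by (rule prob_space_std_gaussian)
  have "integrable std_gaussian (\<lambda>z :: real^'k. (u \<bullet> z)\<^sup>2)"
    using std_gaussian_second_moment unfolding has_second_moment_def
    by (auto simp: has_bochner_integral_iff power2_eq_square)
  then have "integrable std_gaussian (\<lambda>z :: real^'k. u \<bullet> z)"
    by (rule square_integrable_imp_integrable[rotated]) simp
  moreover have "(\<integral>z. u \<bullet> z \<partial>std_gaussian) = 0"
  proof -
    have m1: "(- mat 1 :: real^'k^'k) *v z = - z" for z
      by (simp add: matrix_vector_mult_def vec_eq_iff mat_def sum_negf if_distrib if_distribR cong: if_cong)
    have "orthogonal_matrix (- mat 1 :: real^'k^'k)"
      by (rule orthogonal_matrix_normI) (simp add: m1)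
    then have "(\<integral>z. u \<bullet> z \<partial>std_gaussian) = (\<integral>z. u \<bullet> z \<partial>distr std_gaussian borel ((*v) (- mat 1)))"
      by (simp add: distr_std_gaussian_orthogonal)
    also have "\<dots> = - (\<integral>z. u \<bullet> z \<partial>std_gaussian)"
      by (subst integral_distr) (auto simp: m1)
    finally show ?thesis by simp
  qed
  ultimately show ?thesis by (simp add: has_bochner_integral_iff)
qed

text \<open>Cauchy-Schwarz, obtained from \<open>2 f g \<le> t f\<^sup>2 + g\<^sup>2 / t\<close> with \<open>t = s\<close>, or \<open>t\<close> tending to zero
  when \<open>s = 0\<close>.\<close>

lemma expectation_mult_le:
  fixes f g :: "'w \<Rightarrow> real"
  assumes f: "has_bochner_integral M (\<lambda>\<omega>. f \<omega> * f \<omega>) 1"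
    and g: "has_bochner_integral M (\<lambda>\<omega>. g \<omega> * g \<omega>) (s\<^sup>2)" and s: "0 \<le> s"
    and fg: "integrable M (\<lambda>\<omega>. f \<omega> * g \<omega>)"
  shows "(\<integral>\<omega>. f \<omega> * g \<omega> \<partial>M) \<le> s"
proof -
  have t: "2 * (\<integral>\<omega>. f \<omega> * g \<omega> \<partial>M) \<le> t + s\<^sup>2 / t" if t: "0 < t" for t
  proof -
    have i: "integrable M (\<lambda>\<omega>. t * (f \<omega> * f \<omega>) + g \<omega> * g \<omega> / t)"
      and e: "(\<integral>\<omega>. t * (f \<omega> * f \<omega>) + g \<omega> * g \<omega> / t \<partial>M) = t + s\<^sup>2 / t"
      using f g by (auto simp: has_bochner_integral_iff)
    have "2 * (a * b) \<le> t * (a * a) + b * b / t" for a b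
    proof -
      have "0 \<le> (t * a - b)\<^sup>2 / t" using t by simp
      also have "\<dots> = t * (a * a) + b * b / t - 2 * (a * b)"
        using t by (simp add: power2_eq_square field_simps)
      finally show ?thesis by simp
    qed
    then have "(\<integral>\<omega>. 2 * (f \<omega> * g \<omega>) \<partial>M) \<le> (\<integral>\<omega>. t * (f \<omega> * f \<omega>) + g \<omega> * g \<omega> / t \<partial>M)"
      using fg i by (intro integral_mono) auto
    then show ?thesis using e by simp
  qed
  show ?thesis
  proof (cases "s = 0")
    case False
    with t[of s] s show ?thesis by (simp add: power2_eq_square)
  next
    case True
    show ?thesis
    proof (rule field_le_epsilon)
      fix e :: real assume "0 < e"
      with t[of "2 * e"] True show "(\<integral>\<omega>. f \<omega> * g \<omega> \<partial>M) \<le> s + e" by simp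
    qed
  qed
qed

text \<open>The Gelbrich bound on the correlation of two random vectors with given second moments. After
  whitening \<open>X\<close>, it is the Cauchy-Schwarz inequality in each coordinate of an eigenbasis.\<close>

theorem gelbrich_bound:
  fixes X Y :: "'w \<Rightarrow> real^'k"
  assumes X: "has_second_moment M X S" and S: "pd S"
    and Y: "has_second_moment M Y G" and G: "psd G"
  shows "(\<integral>\<omega>. X \<omega> \<bullet> Y \<omega> \<partial>M) \<le> trace (psd_sqrt (psd_sqrt S ** G ** psd_sqrt S))"
proof -
  define B where "B = psd_sqrt S"
  have tB: "transpose B = B" and BB: "B ** B = S"
    using S unfolding B_def by (auto simp: transpose_psd_sqrt psd_sqrt_square pd_imp_psd)
  obtain T where BT: "B ** T = mat 1" and TB: "T ** B = mat 1"
    using invertible_psd_sqrt[OF S] unfolding invertible_def B_def by blast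
  have "psd (B ** G ** B)" using psd_congruence[OF G, of B] tB by simp
  then obtain V s where V: "orthogonal_matrix V" and s: "\<And>i. 0 \<le> s i"
    and root: "psd_sqrt (B ** G ** B) = V ** diag_matrix s ** transpose V"
    and K: "B ** G ** B = V ** diag_matrix (\<lambda>i. (s i)\<^sup>2) ** transpose V"
    using psd_sqrt_spectral by metis
  have VV: "transpose V ** V = mat 1" "V ** transpose V = mat 1"
    using V by (auto simp: orthogonal_matrix_def)
  define Z where "Z \<omega> = (transpose V ** T) *v X \<omega>" for \<omega>
  define W where "W \<omega> = (transpose V ** B) *v Y \<omega>" for \<omega>
  have "transpose V ** T ** S ** transpose (transpose V ** T)
      = transpose V ** (T ** B) ** transpose (T ** B) ** V"
    by (simp add: matrix_transpose_mul matrix_mul_assoc tB BB[symmetric])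
  then have Z2: "has_second_moment M Z (mat 1)"
    using has_second_moment_mult[OF X, of "transpose V ** T"]
    by (simp add: Z_def[abs_def] TB VV matrix_mul_assoc)
  have "transpose V ** B ** G ** transpose (transpose V ** B) = transpose V ** (B ** G ** B) ** V"
    by (simp add: matrix_transpose_mul matrix_mul_assoc tB)
  also have "\<dots> = (transpose V ** V) ** diag_matrix (\<lambda>i. (s i)\<^sup>2) ** (transpose V ** V)"
    unfolding K by (simp add: matrix_mul_assoc)
  finally have W2: "has_second_moment M W (diag_matrix (\<lambda>i. (s i)\<^sup>2))"
    using has_second_moment_mult[OF Y, of "transpose V ** B"] by (simp add: W_def[abs_def] VV)
  have XY: "X \<omega> \<bullet> Y \<omega> = (\<Sum>i\<in>UNIV. (axis i 1 \<bullet> Z \<omega>) * (axis i 1 \<bullet> W \<omega>))" for \<omega>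
  proof -
    have "Z \<omega> \<bullet> W \<omega> = X \<omega> \<bullet> ((transpose (transpose V ** T) ** (transpose V ** B)) *v Y \<omega>)"
      unfolding Z_def W_def by (simp only: mult_dot_transpose matrix_vector_mul_assoc)
    also have "transpose (transpose V ** T) ** (transpose V ** B) = transpose T ** (V ** transpose V) ** B"
      by (simp add: matrix_transpose_mul matrix_mul_assoc)
    also have "\<dots> = transpose (B ** T)" by (simp add: VV matrix_transpose_mul tB)
    finally have "Z \<omega> \<bullet> W \<omega> = X \<omega> \<bullet> Y \<omega>" by (simp add: BT)
    then show ?thesis by (simp add: inner_axis' inner_vec_def[of "Z \<omega>"])
  qed
  have "(\<integral>\<omega>. X \<omega> \<bullet> Y \<omega> \<partial>M) = (\<Sum>i\<in>UNIV. \<integral>\<omega>. (axis i 1 \<bullet> Z \<omega>) * (axis i 1 \<bullet> W \<omega>) \<partial>M)"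
    unfolding XY by (intro Bochner_Integration.integral_sum has_second_moment_integrable_product[OF Z2 W2])
  also have "\<dots> \<le> (\<Sum>i\<in>UNIV. s i)"
  proof (rule sum_mono)
    fix i
    have "has_bochner_integral M (\<lambda>\<omega>. (axis i 1 \<bullet> W \<omega>) * (axis i 1 \<bullet> W \<omega>))
        (axis i 1 \<bullet> (diag_matrix (\<lambda>i. (s i)\<^sup>2) *v axis i 1))"
      by (rule has_second_momentD[OF W2])
    then have W_i: "has_bochner_integral M (\<lambda>\<omega>. (axis i 1 \<bullet> W \<omega>) * (axis i 1 \<bullet> W \<omega>)) ((s i)\<^sup>2)"
      by (simp only: axis_dot_mult_axis) (simp add: diag_matrix_def)
    have "has_bochner_integral M (\<lambda>\<omega>. (axis i 1 \<bullet> Z \<omega>) * (axis i 1 \<bullet> Z \<omega>))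
        (axis i 1 \<bullet> ((mat 1 :: real^'k^'k) *v axis i 1))"
      by (rule has_second_momentD[OF Z2])
    then have Z_i: "has_bochner_integral M (\<lambda>\<omega>. (axis i 1 \<bullet> Z \<omega>) * (axis i 1 \<bullet> Z \<omega>)) 1"
      by (simp only: axis_dot_mult_axis) (simp add: mat_def)
    show "(\<integral>\<omega>. (axis i 1 \<bullet> Z \<omega>) * (axis i 1 \<bullet> W \<omega>) \<partial>M) \<le> s i"
      by (rule expectation_mult_le[OF Z_i W_i s has_second_moment_integrable_product[OF Z2 W2]])
  qed
  also have "\<dots> = trace (diag_matrix s ** (transpose V ** V))"
    by (simp add: VV trace_def diag_matrix_def)
  also have "\<dots> = trace (psd_sqrt (B ** G ** B))"
    unfolding root by (metis matrix_mul_assoc trace_mul_sym)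
  finally show ?thesis by (simp add: B_def)
qed

section \<open>Block matrices\<close>

lemma inner_stack: "z \<bullet> stack a b = upper z \<bullet> a + lower z \<bullet> b"
  using stack_inner[of "upper z" "lower z"] by simp

lemma block_matrix_mult_vec:
  "block_matrix X11 X12 X21 X22 *v z
    = stack (X11 *v upper z + X12 *v lower z) (X21 *v upper z + X22 *v lower z)"
  by (simp add: vec_eq_iff block_matrix_def stack_def matrix_vector_mult_def sum_UNIV_Plus
      upper_def lower_def split: sum.split)

lemma block_matrix_mult:
  fixes X11 :: "real^'n^'n" and X22 :: "real^'m^'m"
  shows "block_matrix X11 X12 X21 X22 ** block_matrix Y11 Y12 Y21 Y22
    = block_matrix (X11 ** Y11 + X12 ** Y21) (X11 ** Y12 + X12 ** Y22)
        (X21 ** Y11 + X22 ** Y21) (X21 ** Y12 + X22 ** Y22)"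
  by (rule matrix_eq[THEN iffD2])
    (simp add: matrix_vector_mul_assoc[symmetric] block_matrix_mult_vec matrix_vector_right_distrib
      matrix_vector_mult_add_rdistrib algebra_simps)

lemma transpose_block_matrix:
  "transpose (block_matrix X11 X12 X21 X22)
    = block_matrix (transpose X11) (transpose X21) (transpose X12) (transpose X22)"
  by (simp add: vec_eq_iff block_matrix_def transpose_def split: sum.split)

lemma block_matrix_id: "block_matrix (mat 1) 0 0 (mat 1) = mat 1"
  by (simp add: matrix_eq block_matrix_mult_vec)

text \<open>The block lower triangular factor of \<open>sigma2 C Q R\<close> that maps the standardised noise to
  \<open>(w, C w + v)\<close>.\<close>

definition noise_factor :: "real^'n^'m \<Rightarrow> real^'n^'n \<Rightarrow> real^'m^'m \<Rightarrow> real^('n + 'm)^('n + 'm)" where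
  "noise_factor C Q R = block_matrix (psd_sqrt Q) 0 (C ** psd_sqrt Q) (psd_sqrt R)"

lemma noise_factor_mult_vec:
  "noise_factor C Q R *v z = stack (psd_sqrt Q *v upper z)
    (C *v (psd_sqrt Q *v upper z) + psd_sqrt R *v lower z)"
  by (simp add: noise_factor_def block_matrix_mult_vec matrix_vector_mul_assoc)

lemma noise_factor_square:
  fixes C :: "real^'n^'m"
  assumes "psd Q" "psd R"
  shows "noise_factor C Q R ** transpose (noise_factor C Q R) = sigma2 C Q R"
proof -
  have Q: "X ** psd_sqrt Q ** psd_sqrt Q = X ** Q" for X :: "real^'n^'k"
    using psd_sqrt_square[OF assms(1)] by (metis matrix_mul_assoc)
  have "C ** psd_sqrt Q ** (psd_sqrt Q ** transpose C) = C ** Q ** transpose C"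
    by (simp add: matrix_mul_assoc Q)
  then show ?thesis
    using assms
    by (simp add: noise_factor_def sigma2_def transpose_block_matrix block_matrix_mult
        matrix_transpose_mul transpose_psd_sqrt psd_sqrt_square matrix_mul_assoc Q
        transpose_def[of 0] zero_vec_def[symmetric])
qed

lemma psd_sigma2: "psd Q \<Longrightarrow> psd R \<Longrightarrow> psd (sigma2 C Q R)"
  using psd_gram[of "noise_factor C Q R"] by (simp add: noise_factor_square)

lemma pd_sigma2:
  fixes C :: "real^'n^'m"
  assumes Q: "pd Q" and R: "pd R"
  shows "pd (sigma2 C Q R)"
proof -
  have "0 < z \<bullet> (sigma2 C Q R *v z)" if "z \<noteq> 0" for z
  proof -
    define p where "p = upper z + transpose C *v lower z"
    have "z \<bullet> (sigma2 C Q R *v z) = p \<bullet> (Q *v p) + lower z \<bullet> (R *v lower z)"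
      by (simp add: sigma2_def block_matrix_mult_vec inner_stack p_def inner_add_left inner_add_right
          matrix_vector_right_distrib matrix_vector_mult_add_rdistrib
          matrix_vector_mul_assoc[symmetric] dot_mult_transpose[of _ C] del: transpose_matrix_vector)
    moreover have "p \<noteq> 0 \<or> lower z \<noteq> 0"
    proof (rule ccontr)
      assume "\<not> ?thesis"
      then have "upper z = 0" "lower z = 0" by (auto simp: p_def)
      moreover have "z \<bullet> z = upper z \<bullet> upper z + lower z \<bullet> lower z"
        by (metis inner_stack stack_upper_lower)
      ultimately have "z \<bullet> z = 0" by simp
      then show False using that by simp
    qed
    moreover have "0 \<le> p \<bullet> (Q *v p)" "0 \<le> lower z \<bullet> (R *v lower z)"
      "p \<noteq> 0 \<Longrightarrow> 0 < p \<bullet> (Q *v p)" "lower z \<noteq> 0 \<Longrightarrow> 0 < lower z \<bullet> (R *v lower z)"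
      using Q R pd_imp_psd[OF Q] pd_imp_psd[OF R] by (auto simp: pd_def psd_def)
    ultimately show ?thesis by (metis add_nonneg_pos add_pos_nonneg)
  qed
  then show ?thesis
    using psd_sigma2[OF pd_imp_psd[OF Q] pd_imp_psd[OF R], of C] by (simp add: pd_def psd_def)
qed

text \<open>The response of \<open>(x\<^sub>1, y)\<close> to the initial state, \<open>x \<mapsto> (A x, C A x)\<close>.\<close>

definition response :: "real^'n^'n \<Rightarrow> real^'n^'m \<Rightarrow> real^'n^('n + 'm)" where
  "response A C = (\<chi> i. case i of Inl p \<Rightarrow> A $ p | Inr q \<Rightarrow> (C ** A) $ q)"

lemma response_mult_vec: "response A C *v x = stack (A *v x) (C *v (A *v x))"
  by (simp add: response_def vec_eq_iff stack_def matrix_vector_mul_assoc split: sum.split)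
    (simp add: matrix_vector_mult_def)

lemma H_mat_form:
  "x \<bullet> (H_mat A C *v x') = x \<bullet> x' + (response A C *v x) \<bullet> (response A C *v x')"
  by (simp add: H_mat_def response_mult_vec stack_inner inner_add_right
      matrix_vector_mult_add_rdistrib matrix_vector_mul_assoc[symmetric]
      dot_mult_transpose[of _ "transpose _"] del: transpose_matrix_vector)

lemma transpose_H_mat: "transpose (H_mat A C) = H_mat A C"
proof (rule matrix_eq_dotI)
  fix u v
  have "u \<bullet> (transpose (H_mat A C) *v v) = v \<bullet> (H_mat A C *v u)"
    by (metis dot_mult_transpose inner_commute transpose_transpose)
  then show "u \<bullet> (transpose (H_mat A C) *v v) = u \<bullet> (H_mat A C *v v)"
    by (simp add: H_mat_form inner_commute)
qed

section \<open>The law of a path\<close>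

lemma sets_gaussian [measurable_cong, simp]: "sets (gaussian mu S) = sets borel"
  by (simp add: gaussian_def)

lemma prob_space_gaussian: "prob_space (gaussian mu S)"
  unfolding gaussian_def by (intro prob_space.prob_space_distr prob_space_std_gaussian) measurable

text \<open>The path \<open>(x, A x + w, C (A x + w) + v)\<close> driven by a standardised initial state \<open>a\<close> and a
  standardised noise \<open>z\<close>.\<close>

definition path_map ::
  "real^'n^'n \<Rightarrow> real^'n^'m \<Rightarrow> real^'n \<Rightarrow> real^'n^'n \<Rightarrow> real^'m^'m \<Rightarrow> real^'n^'n
    \<Rightarrow> (real^'n) \<times> (real^('n + 'm)) \<Rightarrow> (real^'n) \<times> (real^'n) \<times> (real^'m)" where
  "path_map A C xhat Q R S p =
     (xhat + psd_sqrt S *v fst p,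
      A *v (xhat + psd_sqrt S *v fst p) + psd_sqrt Q *v upper (snd p),
      C *v (A *v (xhat + psd_sqrt S *v fst p) + psd_sqrt Q *v upper (snd p))
        + psd_sqrt R *v lower (snd p))"

lemma measurable_upper [measurable (raw)]: "f \<in> borel_measurable M \<Longrightarrow> (\<lambda>x. upper (f x)) \<in> borel_measurable M"
  and measurable_lower [measurable (raw)]: "f \<in> borel_measurable M \<Longrightarrow> (\<lambda>x. lower (f x)) \<in> borel_measurable M"
  by (auto intro: measurable_compose[OF _ upper_measurable] measurable_compose[OF _ lower_measurable])

lemma borel_measurable_fst [measurable (raw)]:
  fixes f :: "'w \<Rightarrow> 'a::topological_space \<times> 'b::topological_space"
  assumes "f \<in> borel_measurable M"
  shows "(\<lambda>x. fst (f x)) \<in> borel_measurable M"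
  by (rule measurable_compose[OF assms])
    (intro borel_measurable_continuous_onI continuous_on_fst continuous_on_id)

lemma borel_measurable_snd [measurable (raw)]:
  fixes f :: "'w \<Rightarrow> 'a::topological_space \<times> 'b::topological_space"
  assumes "f \<in> borel_measurable M"
  shows "(\<lambda>x. snd (f x)) \<in> borel_measurable M"
  by (rule measurable_compose[OF assms])
    (intro borel_measurable_continuous_onI continuous_on_snd continuous_on_id)

lemma path_map_measurable [measurable]: "path_map A C xhat Q R S \<in> borel_measurable borel"
  unfolding path_map_def[abs_def] by measurable

lemma state_obs_law_eq:
  fixes A :: "real^'n^'n" and C :: "real^'n^'m"
  shows "state_obs_law A C xhat Q R S
    = distr (std_gaussian \<Otimes>\<^sub>M std_gaussian) borel (path_map A C xhat Q R S)"
proof -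
  let ?g = "\<lambda>mu S z. mu + psd_sqrt S *v z"
  note sf = prob_space_imp_sigma_finite[OF prob_space_gaussian]
    prob_space_imp_sigma_finite[OF prob_space_std_gaussian]
  have QR: "gaussian 0 Q \<Otimes>\<^sub>M gaussian 0 R
      = distr (std_gaussian \<Otimes>\<^sub>M std_gaussian) (borel \<Otimes>\<^sub>M borel) (\<lambda>(b, c). (?g 0 Q b, ?g 0 R c))"
    unfolding gaussian_def
  proof (rule pair_measure_distr)
    show "sigma_finite_measure (distr std_gaussian borel (?g 0 R))"
      using sf(1)[of 0 R] by (simp only: gaussian_def)
  qed measurable
  have prod: "gaussian xhat S \<Otimes>\<^sub>M (gaussian 0 Q \<Otimes>\<^sub>M gaussian 0 R)
      = distr (std_gaussian \<Otimes>\<^sub>M (std_gaussian \<Otimes>\<^sub>M std_gaussian)) (borel \<Otimes>\<^sub>M (borel \<Otimes>\<^sub>M borel))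
          (\<lambda>(a, b). (?g xhat S a, (\<lambda>(b, c). (?g 0 Q b, ?g 0 R c)) b))"
    unfolding QR unfolding gaussian_def
  proof (rule pair_measure_distr)
    show "sigma_finite_measure (distr (std_gaussian \<Otimes>\<^sub>M std_gaussian) (borel \<Otimes>\<^sub>M borel)
        (\<lambda>(b, c). (?g 0 Q b, ?g 0 R c)))"
      unfolding QR[symmetric]
      by (intro prob_space_imp_sigma_finite prob_space_pair prob_space_gaussian)
  qed measurable
  have 1: "state_obs_law A C xhat Q R S
      = distr (std_gaussian \<Otimes>\<^sub>M (std_gaussian \<Otimes>\<^sub>M std_gaussian)) borel
          (\<lambda>(a, b, c). path_map A C xhat Q R S (a, stack b c))"
    unfolding state_obs_law_def prod
    by (subst distr_distr) (auto simp: path_map_def o_def case_prod_beta' intro!: distr_cong)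
  have "(std_gaussian :: (real^'n) measure) \<Otimes>\<^sub>M (std_gaussian :: (real^('n + 'm)) measure)
      = distr std_gaussian borel (\<lambda>a. a)
        \<Otimes>\<^sub>M distr (std_gaussian \<Otimes>\<^sub>M std_gaussian) borel (\<lambda>p. stack (fst p) (snd p))"
    by (simp add: distr_std_gaussian_stack distr_id2)
  also have "\<dots> = distr (std_gaussian \<Otimes>\<^sub>M (std_gaussian \<Otimes>\<^sub>M std_gaussian)) (borel \<Otimes>\<^sub>M borel)
      (\<lambda>(a, p). (a, stack (fst p) (snd p)))"
  proof (rule pair_measure_distr)
    show "sigma_finite_measure (distr (std_gaussian \<Otimes>\<^sub>M std_gaussian) borel
        (\<lambda>p :: (real^'n) \<times> (real^'m). stack (fst p) (snd p)))"
      unfolding distr_std_gaussian_stack by (rule sf)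
  qed measurable
  finally have 2: "(std_gaussian :: (real^'n) measure) \<Otimes>\<^sub>M (std_gaussian :: (real^('n + 'm)) measure)
      = distr (std_gaussian \<Otimes>\<^sub>M (std_gaussian \<Otimes>\<^sub>M std_gaussian)) (borel \<Otimes>\<^sub>M borel)
          (\<lambda>(a, p). (a, stack (fst p) (snd p)))" .
  show ?thesis
    unfolding 1 2 by (subst distr_distr) (auto simp: borel_prod o_def case_prod_beta' intro!: distr_cong)
qed

text \<open>The part \<open>(w, C w + v)\<close> of \<open>(x\<^sub>1, y)\<close> that is due to the noise.\<close>

definition path_noise ::
  "real^'n^'n \<Rightarrow> real^'n^'m \<Rightarrow> (real^'n) \<times> (real^'n) \<times> (real^'m) \<Rightarrow> real^('n + 'm)" where
  "path_noise A C p = stack (fst (snd p)) (snd (snd p)) - response A C *v fst p"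

lemma path_noise_measurable [measurable]: "path_noise A C \<in> borel_measurable borel"
  unfolding path_noise_def[abs_def] by measurable

lemma fst_path_map: "fst (path_map A C xhat Q R S p) = xhat + psd_sqrt S *v fst p"
  by (simp add: path_map_def)

lemma path_noise_path_map:
  "path_noise A C (path_map A C xhat Q R S p) = noise_factor C Q R *v snd p"
  by (simp add: path_noise_def path_map_def response_mult_vec noise_factor_mult_vec stack_diff
      stack_add algebra_simps)

lemma distr_pair_snd:
  assumes "prob_space M" "prob_space N"
  shows "distr (M \<Otimes>\<^sub>M N) N snd = N"
proof (rule measure_eqI)
  interpret M: prob_space M by fact
  interpret N: prob_space N by fact
  fix B assume "B \<in> sets (distr (M \<Otimes>\<^sub>M N) N snd)"
  then have B: "B \<in> sets N" by simp
  then have "snd -` B \<inter> space (M \<Otimes>\<^sub>M N) = space M \<times> B"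
    by (auto simp: space_pair_measure dest: sets.sets_into_space)
  then show "emeasure (distr (M \<Otimes>\<^sub>M N) N snd) B = emeasure N B"
    using B by (simp add: emeasure_distr N.emeasure_pair_measure_Times M.emeasure_space_1)
qed simp

lemma distr_std_pair_fst: "distr (std_gaussian \<Otimes>\<^sub>M std_gaussian) borel fst = std_gaussian"
  and distr_std_pair_snd: "distr (std_gaussian \<Otimes>\<^sub>M std_gaussian) borel snd = std_gaussian"
  using prob_space.distr_pair_fst[OF prob_space_std_gaussian, of std_gaussian]
    distr_pair_snd[OF prob_space_std_gaussian prob_space_std_gaussian]
  by (simp_all cong: distr_cong)

lemma path_map_measurable_pair [measurable]:
  fixes A :: "real^'n^'n" and C :: "real^'n^'m"
  shows "path_map A C xhat Q R S \<in> borel_measurable (std_gaussian \<Otimes>\<^sub>M std_gaussian)"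
proof -
  have "sets ((std_gaussian :: (real^'n) measure) \<Otimes>\<^sub>M (std_gaussian :: (real^('n + 'm)) measure)) = sets borel"
    unfolding borel_prod[symmetric] by (rule sets_pair_measure_cong) simp_all
  from measurable_cong_sets[OF this refl] show ?thesis using path_map_measurable by blast
qed

lemma path_law_initial_second_moment:
  fixes A :: "real^'n^'n" and C :: "real^'n^'m"
  assumes Z[measurable]: "Z \<in> borel_measurable M"
    and law: "distr M borel Z = state_obs_law A C xhat Q R S" and S: "psd S"
  shows "has_second_moment M (\<lambda>\<omega>. fst (Z \<omega>) - xhat) S"
proof -
  let ?P = "(std_gaussian :: (real^'n) measure) \<Otimes>\<^sub>M (std_gaussian :: (real^('n + 'm)) measure)"
  have "has_second_moment (distr ?P borel fst) (\<lambda>z. z) (mat 1)"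
    unfolding distr_std_pair_fst by (rule std_gaussian_second_moment)
  then have "has_second_moment ?P fst (mat 1)"
    by (subst (asm) has_second_moment_distr) auto
  from has_second_moment_mult[OF this, of "psd_sqrt S"]
  have "has_second_moment ?P (\<lambda>p. psd_sqrt S *v fst p) S"
    using S by (simp add: transpose_psd_sqrt psd_sqrt_square)
  then have "has_second_moment (distr ?P borel (path_map A C xhat Q R S)) (\<lambda>p. fst p - xhat) S"
    by (subst has_second_moment_distr) (auto simp: fst_path_map)
  then have "has_second_moment (distr M borel Z) (\<lambda>p. fst p - xhat) S"
    by (simp add: law state_obs_law_eq)
  then show ?thesis by (subst (asm) has_second_moment_distr) auto
qed

lemma path_law_noise:
  fixes A :: "real^'n^'n" and C :: "real^'n^'m"
  assumes Z[measurable]: "Z \<in> borel_measurable M"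
    and law: "distr M borel Z = state_obs_law A C xhat Q R S"
  shows "distr M borel (\<lambda>\<omega>. path_noise A C (Z \<omega>)) = distr std_gaussian borel ((*v) (noise_factor C Q R))"
proof -
  let ?P = "(std_gaussian :: (real^'n) measure) \<Otimes>\<^sub>M (std_gaussian :: (real^('n + 'm)) measure)"
  have "distr M borel (\<lambda>\<omega>. path_noise A C (Z \<omega>)) = distr (distr M borel Z) borel (path_noise A C)"
    by (subst distr_distr) (auto simp: o_def)
  also have "\<dots> = distr ?P borel (\<lambda>p. noise_factor C Q R *v snd p)"
    unfolding law state_obs_law_eq
    by (subst distr_distr) (auto simp: o_def path_noise_path_map)
  also have "\<dots> = distr (distr ?P borel snd) borel ((*v) (noise_factor C Q R))"
    by (subst distr_distr) (auto simp: o_def)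
  finally show ?thesis unfolding distr_std_pair_snd .
qed

lemma path_law_noise_second_moment:
  fixes A :: "real^'n^'n" and C :: "real^'n^'m"
  assumes Z[measurable]: "Z \<in> borel_measurable M"
    and law: "distr M borel Z = state_obs_law A C xhat Q R S" and "psd Q" "psd R"
  shows "has_second_moment M (\<lambda>\<omega>. path_noise A C (Z \<omega>)) (sigma2 C Q R)"
proof -
  have "has_second_moment std_gaussian (\<lambda>z. noise_factor C Q R *v z) (sigma2 C Q R)"
    using has_second_moment_mult[OF std_gaussian_second_moment, of "noise_factor C Q R"] assms(3,4)
    by (simp add: noise_factor_square)
  then have "has_second_moment (distr std_gaussian borel ((*v) (noise_factor C Q R))) (\<lambda>z. z) (sigma2 C Q R)"
    by (subst has_second_moment_distr) auto
  then have "has_second_moment (distr M borel (\<lambda>\<omega>. path_noise A C (Z \<omega>))) (\<lambda>z. z) (sigma2 C Q R)"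
    by (simp add: path_law_noise[OF Z law])
  then show ?thesis by (subst (asm) has_second_moment_distr) auto
qed

lemma path_law_noise_mean:
  fixes A :: "real^'n^'n" and C :: "real^'n^'m"
  assumes Z[measurable]: "Z \<in> borel_measurable M"
    and law: "distr M borel Z = state_obs_law A C xhat Q R S"
  shows "has_bochner_integral M (\<lambda>\<omega>. u \<bullet> path_noise A C (Z \<omega>)) 0"
proof -
  let ?L = "noise_factor C Q R"
  have "has_bochner_integral std_gaussian (\<lambda>z. u \<bullet> (?L *v z)) 0"
    using std_gaussian_mean[of "transpose ?L *v u"] by (simp only: dot_mult_transpose)
  then have "has_bochner_integral (distr std_gaussian borel ((*v) ?L)) (\<lambda>z. u \<bullet> z) 0"
    by (simp add: has_bochner_integral_iff integrable_distr_eq integral_distr)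
  then have "has_bochner_integral (distr M borel (\<lambda>\<omega>. path_noise A C (Z \<omega>))) (\<lambda>z. u \<bullet> z) 0"
    by (simp add: path_law_noise[OF Z law])
  then show ?thesis
    by (simp add: has_bochner_integral_iff integrable_distr_eq integral_distr)
qed

section \<open>Independence of the noise from the other initial state\<close>

lemma kernel_emeasure_measurable [measurable]:
  assumes "\<kappa> \<in> borel \<rightarrow>\<^sub>M prob_algebra borel" "B \<in> sets borel"
  shows "(\<lambda>x. emeasure (\<kappa> x) B) \<in> borel_measurable borel"
  using measurable_compose[OF measurable_prob_algebraD[OF assms(1)] measurable_emeasure_subprob_algebra[OF assms(2)]] .

lemma nn_integral_pair_product:
  assumes "sigma_finite_measure N" and [measurable]: "f \<in> borel_measurable M" "g \<in> borel_measurable N"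
  shows "(\<integral>\<^sup>+p. f (fst p) * g (snd p) \<partial>(M \<Otimes>\<^sub>M N)) = (\<integral>\<^sup>+x. f x \<partial>M) * (\<integral>\<^sup>+y. g y \<partial>N)"
proof -
  interpret N: sigma_finite_measure N by fact
  have "(\<integral>\<^sup>+p. f (fst p) * g (snd p) \<partial>(M \<Otimes>\<^sub>M N)) = (\<integral>\<^sup>+x. \<integral>\<^sup>+y. f x * g y \<partial>N \<partial>M)"
    by (subst N.nn_integral_fst[symmetric]) auto
  then show ?thesis by (simp add: nn_integral_cmult nn_integral_multc)
qed

text \<open>If the conditional law of \<open>Y\<close> given the whole path \<open>Z\<close> only depends on the initial state of
  \<open>Z\<close>, then \<open>Y\<close> is independent of the noise of \<open>Z\<close>, because the noise is independent of that
  initial state.\<close>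

lemma same_cond_law_imp_indep_noise:
  fixes A :: "real^'n^'n" and C :: "real^'n^'m" and Y :: "'w \<Rightarrow> 'y::second_countable_topology"
  assumes "prob_space M" and Z[measurable]: "Z \<in> borel_measurable M"
    and law: "distr M borel Z = state_obs_law A C xhat Q R S"
    and Y[measurable]: "Y \<in> borel_measurable M" and same: "same_cond_law M Y Z (fst \<circ> Z)"
    and f[measurable]: "f \<in> borel_measurable borel" and h[measurable]: "h \<in> borel_measurable borel"
  shows "prob_space.indep_var M borel (\<lambda>\<omega>. f (Y \<omega>) :: real) borel (\<lambda>\<omega>. h (path_noise A C (Z \<omega>)) :: real)"
proof -
  interpret prob_space M by fact
  let ?E = "\<lambda>\<omega>. path_noise A C (Z \<omega>)"
  let ?N = "std_gaussian :: (real^('n + 'm)) measure"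
  have sfN: "sigma_finite_measure ?N"
    by (intro prob_space_imp_sigma_finite prob_space_std_gaussian)
  obtain \<kappa> \<kappa>' where \<kappa>: "is_cond_law M Y Z \<kappa>" and \<kappa>': "is_cond_law M Y (fst \<circ> Z) \<kappa>'"
    and ae: "AE \<omega> in M. \<kappa> (Z \<omega>) = \<kappa>' ((fst \<circ> Z) \<omega>)"
    using same unfolding same_cond_law_def by blast
  have kk[measurable]: "\<kappa>' \<in> borel \<rightarrow>\<^sub>M prob_algebra borel" using \<kappa>' by (simp add: is_cond_law_def)
  have factor: "emeasure M {\<omega> \<in> space M. ?E \<omega> \<in> U \<and> Y \<omega> \<in> B}
      = (\<integral>\<^sup>+a. emeasure (\<kappa>' (xhat + psd_sqrt S *v a)) B \<partial>std_gaussian)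
        * (\<integral>\<^sup>+z. indicator U (noise_factor C Q R *v z) \<partial>?N)"
    if U[measurable]: "U \<in> sets borel" and B[measurable]: "B \<in> sets borel" for U B
  proof -
    let ?U = "path_noise A C -` U"
    have "?U = path_noise A C -` U \<inter> space borel" by simp
    then have U': "?U \<in> sets borel" by (metis measurable_sets path_noise_measurable U)
    have [measurable]: "(\<lambda>x. emeasure (\<kappa>' x) B) \<in> borel_measurable borel"
      by (rule kernel_emeasure_measurable) (use kk B in auto)
    let ?f = "\<lambda>p. indicator U (path_noise A C p) * emeasure (\<kappa>' (fst p)) B :: ennreal"
    have [measurable]: "?f \<in> borel_measurable borel" by measurable
    have "emeasure M {\<omega> \<in> space M. ?E \<omega> \<in> U \<and> Y \<omega> \<in> B}
        = emeasure M {\<omega> \<in> space M. Z \<omega> \<in> ?U \<and> Y \<omega> \<in> B}" by simp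
    also have "\<dots> = (\<integral>\<^sup>+\<omega>. indicator ?U (Z \<omega>) * emeasure (\<kappa> (Z \<omega>)) B \<partial>M)"
      using \<kappa> U' B unfolding is_cond_law_def by blast
    also have "\<dots> = (\<integral>\<^sup>+\<omega>. ?f (Z \<omega>) \<partial>M)"
      by (rule nn_integral_cong_AE) (use ae in \<open>auto simp: indicator_def\<close>)
    also have "\<dots> = (\<integral>\<^sup>+p. ?f p \<partial>distr M borel Z)"
      by (rule nn_integral_distr[symmetric]) auto
    also have "\<dots> = (\<integral>\<^sup>+p. ?f (path_map A C xhat Q R S p) \<partial>(std_gaussian \<Otimes>\<^sub>M std_gaussian))"
      unfolding law state_obs_law_eq by (rule nn_integral_distr) auto
    also have "\<dots> = (\<integral>\<^sup>+p. emeasure (\<kappa>' (xhat + psd_sqrt S *v fst p)) B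
        * indicator U (noise_factor C Q R *v snd p) \<partial>(std_gaussian \<Otimes>\<^sub>M std_gaussian))"
      by (simp add: fst_path_map path_noise_path_map mult.commute)
    also have "\<dots> = (\<integral>\<^sup>+a. emeasure (\<kappa>' (xhat + psd_sqrt S *v a)) B \<partial>std_gaussian)
        * (\<integral>\<^sup>+z. indicator U (noise_factor C Q R *v z) \<partial>?N)"
      by (rule nn_integral_pair_product[OF sfN]) measurable
    finally show ?thesis .
  qed
  have one: "(\<integral>\<^sup>+z. indicator UNIV (noise_factor C Q R *v z) \<partial>?N) = 1"
    using prob_space.emeasure_space_1[of ?N] prob_space_std_gaussian by simp
  have Yeq: "emeasure M {\<omega> \<in> space M. Y \<omega> \<in> B}
      = (\<integral>\<^sup>+a. emeasure (\<kappa>' (xhat + psd_sqrt S *v a)) B \<partial>std_gaussian)" if "B \<in> sets borel" for B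
    using factor[of UNIV B] that one by simp
  have Eeq: "emeasure M {\<omega> \<in> space M. ?E \<omega> \<in> U}
      = (\<integral>\<^sup>+z. indicator U (noise_factor C Q R *v z) \<partial>?N)" if "U \<in> sets borel" for U
    using factor[of U UNIV] that Yeq[of UNIV] by (simp add: emeasure_space_1)
  let ?f = "\<lambda>\<omega>. f (Y \<omega>)" and ?h = "\<lambda>\<omega>. h (?E \<omega>)"
  have "distr M borel ?f \<Otimes>\<^sub>M distr M borel ?h = distr M (borel \<Otimes>\<^sub>M borel) (\<lambda>\<omega>. (?f \<omega>, ?h \<omega>))"
  proof (rule pair_measure_eqI)
    show "sigma_finite_measure (distr M borel ?f)" "sigma_finite_measure (distr M borel ?h)"
      by (auto intro!: prob_space_imp_sigma_finite prob_space_distr)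
    fix B U assume "B \<in> sets (distr M borel ?f)" "U \<in> sets (distr M borel ?h)"
    then have BU[measurable]: "B \<in> sets borel" "U \<in> sets borel" by auto
    have fB: "f -` B \<in> sets borel" "h -` U \<in> sets borel"
      using measurable_sets[OF f BU(1)] measurable_sets[OF h BU(2)] by auto
    have eqs: "?f -` B \<inter> space M = {\<omega> \<in> space M. Y \<omega> \<in> f -` B}"
      "?h -` U \<inter> space M = {\<omega> \<in> space M. ?E \<omega> \<in> h -` U}"
      "(\<lambda>\<omega>. (?f \<omega>, ?h \<omega>)) -` (B \<times> U) \<inter> space M = {\<omega> \<in> space M. ?E \<omega> \<in> h -` U \<and> Y \<omega> \<in> f -` B}"
      by auto
    have "emeasure (distr M borel ?f) B = emeasure M {\<omega> \<in> space M. Y \<omega> \<in> f -` B}"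
      "emeasure (distr M borel ?h) U = emeasure M {\<omega> \<in> space M. ?E \<omega> \<in> h -` U}"
      "emeasure (distr M (borel \<Otimes>\<^sub>M borel) (\<lambda>\<omega>. (?f \<omega>, ?h \<omega>))) (B \<times> U)
        = emeasure M {\<omega> \<in> space M. ?E \<omega> \<in> h -` U \<and> Y \<omega> \<in> f -` B}"
      unfolding eqs[symmetric] by (rule emeasure_distr; measurable)+
    then show "emeasure (distr M borel ?f) B * emeasure (distr M borel ?h) U
        = emeasure (distr M (borel \<Otimes>\<^sub>M borel) (\<lambda>\<omega>. (?f \<omega>, ?h \<omega>))) (B \<times> U)"
      by (simp only: Yeq[OF fB(1)] Eeq[OF fB(2)] factor[OF fB(2,1)])
  qed simp
  then show ?thesis by (simp add: indep_var_distribution_eq)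
qed

lemma is_cond_law_deterministic:
  fixes X :: "'w \<Rightarrow> 'x::topological_space" and Y :: "'w \<Rightarrow> 'y::topological_space"
  assumes [measurable]: "X \<in> borel_measurable M" "f \<in> borel_measurable borel"
    and ae: "AE \<omega> in M. Y \<omega> = f (X \<omega>)" and [measurable]: "Y \<in> borel_measurable M"
  shows "is_cond_law M Y X (\<lambda>x. return borel (f x))"
  unfolding is_cond_law_def
proof (intro conjI ballI)
  show "(\<lambda>x. return borel (f x)) \<in> borel \<rightarrow>\<^sub>M prob_algebra borel"
    by (rule measurable_compose[OF assms(2) measurable_return_prob_space])
  fix U B assume [measurable]: "U \<in> sets (borel :: 'x measure)" "B \<in> sets (borel :: 'y measure)"
  have "emeasure M {\<omega> \<in> space M. X \<omega> \<in> U \<and> Y \<omega> \<in> B}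
      = (\<integral>\<^sup>+\<omega>. indicator {\<omega> \<in> space M. X \<omega> \<in> U \<and> Y \<omega> \<in> B} \<omega> \<partial>M)"
    by (rule nn_integral_indicator[symmetric]) measurable
  also have "\<dots> = (\<integral>\<^sup>+\<omega>. indicator U (X \<omega>) * emeasure (return borel (f (X \<omega>))) B \<partial>M)"
    by (rule nn_integral_cong_AE) (use ae in \<open>auto simp: indicator_def\<close>)
  finally show "emeasure M {\<omega> \<in> space M. X \<omega> \<in> U \<and> Y \<omega> \<in> B}
      = (\<integral>\<^sup>+\<omega>. indicator U (X \<omega>) * emeasure (return borel (f (X \<omega>))) B \<partial>M)" .
qed

text \<open>A function of the initial state of a path is conditionally deterministic, so it is covered by
  the independence lemma as well.\<close>

lemma same_cond_law_initial:
  fixes Z :: "'w \<Rightarrow> (real^'n) \<times> 'z::second_countable_topology"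
  assumes [measurable]: "Z \<in> borel_measurable M"
  shows "same_cond_law M (fst \<circ> Z) Z (fst \<circ> Z)"
  unfolding same_cond_law_def
proof (intro exI conjI)
  show "is_cond_law M (fst \<circ> Z) Z (\<lambda>p. return borel (fst p))"
    by (rule is_cond_law_deterministic) (auto simp: o_def)
  show "is_cond_law M (fst \<circ> Z) (fst \<circ> Z) (\<lambda>x. return borel x)"
    by (rule is_cond_law_deterministic) (auto simp: o_def)
qed auto

text \<open>The mixed terms of the cost vanish, since the noise is independent of \<open>Y\<close> and has mean zero.\<close>

lemma noise_uncorrelated:
  fixes A :: "real^'n^'n" and C :: "real^'n^'m" and Y :: "'w \<Rightarrow> real^'n"
  assumes M: "prob_space M" and Z[measurable]: "Z \<in> borel_measurable M"
    and law: "distr M borel Z = state_obs_law A C xhat Q R S"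
    and Y[measurable]: "Y \<in> borel_measurable M" and same: "same_cond_law M Y Z (fst \<circ> Z)"
    and sm: "has_second_moment M (\<lambda>\<omega>. Y \<omega> - c) G"
  shows "has_bochner_integral M (\<lambda>\<omega>. (D *v (Y \<omega> - c)) \<bullet> path_noise A C (Z \<omega>)) 0"
proof -
  interpret prob_space M by (rule M)
  let ?E = "\<lambda>\<omega>. path_noise A C (Z \<omega>)"
  have "has_bochner_integral M (\<lambda>\<omega>. (axis i 1 \<bullet> (D *v (Y \<omega> - c))) * (axis i 1 \<bullet> ?E \<omega>)) 0" for i
  proof -
    let ?g = "\<lambda>y. axis i 1 \<bullet> (D *v (y - c))"
    have ind: "indep_var borel (\<lambda>\<omega>. ?g (Y \<omega>)) borel (\<lambda>\<omega>. axis i 1 \<bullet> ?E \<omega>)"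
      by (rule same_cond_law_imp_indep_noise[OF M Z law Y same]) measurable
    have "has_second_moment M (\<lambda>\<omega>. D *v (Y \<omega> - c)) (D ** G ** transpose D)"
      by (rule has_second_moment_mult[OF sm])
    from has_second_momentD[OF this, of "axis i 1" "axis i 1"]
    have "integrable M (\<lambda>\<omega>. (?g (Y \<omega>))\<^sup>2)"
      by (auto simp: has_bochner_integral_iff power2_eq_square)
    then have int: "integrable M (\<lambda>\<omega>. ?g (Y \<omega>))"
      by (rule square_integrable_imp_integrable[rotated]) measurable
    have m: "has_bochner_integral M (\<lambda>\<omega>. axis i 1 \<bullet> ?E \<omega>) 0"
      by (rule path_law_noise_mean[OF Z law])
    show ?thesis
      using indep_var_lebesgue_integral[OF ind int] indep_var_integrable[OF ind int] m
      by (simp add: has_bochner_integral_iff)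
  qed
  from has_bochner_integral_sum[of UNIV, OF this]
  show ?thesis by (simp add: inner_axis' inner_vec_def[of "D *v _"])
qed

section \<open>The cost of a bicausal coupling\<close>

lemma path_cost_eq:
  fixes A :: "real^'n^'n" and C :: "real^'n^'m"
  defines "D \<equiv> response A C"
  assumes a: "a = fst p - c" and a': "a' = fst p' - c"
    and e: "e = path_noise A C p" and e': "e' = path_noise A C p'"
  shows "(norm (fst p - fst p'))\<^sup>2 + (norm (fst (snd p) - fst (snd p')))\<^sup>2
      + (norm (snd (snd p) - snd (snd p')))\<^sup>2
    = a \<bullet> (H_mat A C *v a) + a' \<bullet> (H_mat A C *v a') - 2 * (a \<bullet> (H_mat A C *v a'))
      + e \<bullet> e + e' \<bullet> e' - 2 * (e \<bullet> e')
      + 2 * ((D *v a) \<bullet> e) - 2 * ((D *v a') \<bullet> e) - 2 * ((D *v a) \<bullet> e') + 2 * ((D *v a') \<bullet> e')"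
proof -
  have diff: "stack (fst (snd p) - fst (snd p')) (snd (snd p) - snd (snd p'))
      = (e - e') + (D *v a - D *v a')"
    unfolding a a' e e' path_noise_def D_def stack_diff[symmetric]
    by (simp add: matrix_vector_mult_diff_distrib)
  have "(norm (fst (snd p) - fst (snd p')))\<^sup>2 + (norm (snd (snd p) - snd (snd p')))\<^sup>2
      = stack (fst (snd p) - fst (snd p')) (snd (snd p) - snd (snd p'))
        \<bullet> stack (fst (snd p) - fst (snd p')) (snd (snd p) - snd (snd p'))"
    unfolding stack_inner unfolding dot_square_norm ..
  moreover have "(norm (fst p - fst p'))\<^sup>2 = (a - a') \<bullet> (a - a')"
    by (simp add: a a' dot_square_norm)
  ultimately show ?thesis
    unfolding diff H_mat_form D_def[symmetric]
    by (simp add: inner_add_left inner_add_right inner_diff_left inner_diff_right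
        inner_commute[of a' a] inner_commute[of e' e] inner_commute[of e "D *v _"]
        inner_commute[of e' "D *v _"] inner_commute[of "D *v a'" "D *v a"])
qed

text \<open>The cost depends on the coupling only through two correlations, each of which is subject to the
  Gelbrich bound.\<close>

lemma bicausal_coupling_cost:
  fixes A :: "real^'n^'n" and C :: "real^'n^'m"
  assumes \<pi>: "\<pi> \<in> bicausal_couplings (state_obs_law A C xhat Q R S) (state_obs_law A C xhat Q' R' S')"
    and psd: "psd Q" "psd R" "psd S" "psd Q'" "psd R'" "psd S'"
  shows "enn2ereal (\<integral>\<^sup>+((x0, x1, y), (x0', x1', y')).
      ennreal ((norm (x0 - x0'))\<^sup>2 + (norm (x1 - x1'))\<^sup>2 + (norm (y - y'))\<^sup>2) \<partial>\<pi>)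
    = ereal (trace (H_mat A C ** S) + trace (H_mat A C ** S')
        - 2 * (\<integral>\<omega>. (fst (fst \<omega>) - xhat) \<bullet> (H_mat A C *v (fst (snd \<omega>) - xhat)) \<partial>\<pi>)
        + trace (sigma2 C Q R) + trace (sigma2 C Q' R')
        - 2 * (\<integral>\<omega>. path_noise A C (fst \<omega>) \<bullet> path_noise A C (snd \<omega>) \<partial>\<pi>))" (is ?cost)
    and "pd S \<Longrightarrow> (\<integral>\<omega>. (fst (fst \<omega>) - xhat) \<bullet> (H_mat A C *v (fst (snd \<omega>) - xhat)) \<partial>\<pi>)
      \<le> trace (psd_sqrt (psd_sqrt S ** H_mat A C ** S' ** H_mat A C ** psd_sqrt S))" (is "_ \<Longrightarrow> ?initial")
    and "pd Q \<Longrightarrow> pd R \<Longrightarrow> (\<integral>\<omega>. path_noise A C (fst \<omega>) \<bullet> path_noise A C (snd \<omega>) \<partial>\<pi>)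
      \<le> trace (psd_sqrt (psd_sqrt (sigma2 C Q R) ** sigma2 C Q' R' ** psd_sqrt (sigma2 C Q R)))" (is "_ \<Longrightarrow> _ \<Longrightarrow> ?noise")
proof -
  have sets_\<pi>[measurable_cong]: "sets \<pi> = sets borel" and M: "prob_space \<pi>"
    and law: "distr \<pi> borel fst = state_obs_law A C xhat Q R S"
    and law': "distr \<pi> borel snd = state_obs_law A C xhat Q' R' S'"
    and same: "same_cond_law \<pi> (fst \<circ> snd) fst (fst \<circ> fst)"
    and same': "same_cond_law \<pi> (fst \<circ> fst) snd (fst \<circ> snd)"
    using \<pi> by (auto simp: bicausal_couplings_def couplings_def space_prob_algebra)
  let ?H = "H_mat A C"
  define D where "D = response A C"
  define a where "a \<omega> = fst (fst \<omega>) - xhat" for \<omega> :: "((real^'n) \<times> (real^'n) \<times> (real^'m)) \<times> ((real^'n) \<times> (real^'n) \<times> (real^'m))"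
  define a' where "a' \<omega> = fst (snd \<omega>) - xhat" for \<omega> :: "((real^'n) \<times> (real^'n) \<times> (real^'m)) \<times> ((real^'n) \<times> (real^'n) \<times> (real^'m))"
  define e where "e \<omega> = path_noise A C (fst \<omega>)" for \<omega> :: "((real^'n) \<times> (real^'n) \<times> (real^'m)) \<times> ((real^'n) \<times> (real^'n) \<times> (real^'m))"
  define e' where "e' \<omega> = path_noise A C (snd \<omega>)" for \<omega> :: "((real^'n) \<times> (real^'n) \<times> (real^'m)) \<times> ((real^'n) \<times> (real^'n) \<times> (real^'m))"
  have fst_m: "fst \<in> borel_measurable \<pi>" and snd_m: "snd \<in> borel_measurable \<pi>" by measurable
  have ff_m: "fst \<circ> fst \<in> borel_measurable \<pi>" and fs_m: "fst \<circ> snd \<in> borel_measurable \<pi>"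
    unfolding o_def by measurable
  have a2: "has_second_moment \<pi> a S"
    unfolding a_def[abs_def] by (rule path_law_initial_second_moment[OF fst_m law psd(3)])
  have a'2: "has_second_moment \<pi> a' S'"
    unfolding a'_def[abs_def] by (rule path_law_initial_second_moment[OF snd_m law' psd(6)])
  have e2: "has_second_moment \<pi> e (sigma2 C Q R)"
    unfolding e_def[abs_def] by (rule path_law_noise_second_moment[OF fst_m law psd(1,2)])
  have e'2: "has_second_moment \<pi> e' (sigma2 C Q' R')"
    unfolding e'_def[abs_def] by (rule path_law_noise_second_moment[OF snd_m law' psd(4,5)])
  have ae: "has_bochner_integral \<pi> (\<lambda>\<omega>. (D *v a \<omega>) \<bullet> e \<omega>) 0"
    using noise_uncorrelated[OF M fst_m law ff_m same_cond_law_initial[OF fst_m]] a2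
    by (simp add: a_def[abs_def] e_def)
  have a'e: "has_bochner_integral \<pi> (\<lambda>\<omega>. (D *v a' \<omega>) \<bullet> e \<omega>) 0"
    using noise_uncorrelated[OF M fst_m law fs_m same] a'2
    by (simp add: a'_def[abs_def] e_def)
  have ae': "has_bochner_integral \<pi> (\<lambda>\<omega>. (D *v a \<omega>) \<bullet> e' \<omega>) 0"
    using noise_uncorrelated[OF M snd_m law' ff_m same'] a2
    by (simp add: a_def[abs_def] e'_def)
  have a'e': "has_bochner_integral \<pi> (\<lambda>\<omega>. (D *v a' \<omega>) \<bullet> e' \<omega>) 0"
    using noise_uncorrelated[OF M snd_m law' fs_m same_cond_law_initial[OF snd_m]] a'2
    by (simp add: a'_def[abs_def] e'_def)
  have Ha'2: "has_second_moment \<pi> (\<lambda>\<omega>. ?H *v a' \<omega>) (?H ** S' ** ?H)"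
    using has_second_moment_mult[OF a'2, of ?H] by (simp add: transpose_H_mat)
  have aHa': "has_bochner_integral \<pi> (\<lambda>\<omega>. a \<omega> \<bullet> (?H *v a' \<omega>)) (\<integral>\<omega>. a \<omega> \<bullet> (?H *v a' \<omega>) \<partial>\<pi>)"
    using has_second_moment_integrable_inner[OF a2 Ha'2] by (simp add: has_bochner_integral_iff)
  have ee': "has_bochner_integral \<pi> (\<lambda>\<omega>. e \<omega> \<bullet> e' \<omega>) (\<integral>\<omega>. e \<omega> \<bullet> e' \<omega> \<partial>\<pi>)"
    using has_second_moment_integrable_inner[OF e2 e'2] by (simp add: has_bochner_integral_iff)
  define c where "c \<omega> = a \<omega> \<bullet> (?H *v a \<omega>) + a' \<omega> \<bullet> (?H *v a' \<omega>) - 2 * (a \<omega> \<bullet> (?H *v a' \<omega>))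
      + e \<omega> \<bullet> e \<omega> + e' \<omega> \<bullet> e' \<omega> - 2 * (e \<omega> \<bullet> e' \<omega>)
      + 2 * ((D *v a \<omega>) \<bullet> e \<omega>) - 2 * ((D *v a' \<omega>) \<bullet> e \<omega>)
      - 2 * ((D *v a \<omega>) \<bullet> e' \<omega>) + 2 * ((D *v a' \<omega>) \<bullet> e' \<omega>)" for \<omega>
  have c_eq: "c \<omega> = (norm (fst (fst \<omega>) - fst (snd \<omega>)))\<^sup>2 + (norm (fst (snd (fst \<omega>)) - fst (snd (snd \<omega>))))\<^sup>2
      + (norm (snd (snd (fst \<omega>)) - snd (snd (snd \<omega>))))\<^sup>2" for \<omega>
    unfolding c_def D_def by (rule path_cost_eq[symmetric]) (simp_all add: a_def a'_def e_def e'_def)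
  have int: "has_bochner_integral \<pi> c
     (trace (?H ** S) + trace (?H ** S') - 2 * (\<integral>\<omega>. a \<omega> \<bullet> (?H *v a' \<omega>) \<partial>\<pi>)
      + trace (sigma2 C Q R) + trace (sigma2 C Q' R') - 2 * (\<integral>\<omega>. e \<omega> \<bullet> e' \<omega> \<partial>\<pi>)
      + 2 * 0 - 2 * 0 - 2 * 0 + 2 * 0)"
    unfolding c_def
    by (intro has_bochner_integral_add has_bochner_integral_diff has_bochner_integral_mult_right
        has_second_moment_quadratic_form[OF a2] has_second_moment_quadratic_form[OF a'2]
        has_second_moment_norm_square[OF e2] has_second_moment_norm_square[OF e'2]
        aHa' ee' ae a'e ae' a'e')
  have "(\<integral>\<^sup>+((x0, x1, y), (x0', x1', y')).
      ennreal ((norm (x0 - x0'))\<^sup>2 + (norm (x1 - x1'))\<^sup>2 + (norm (y - y'))\<^sup>2) \<partial>\<pi>)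
      = (\<integral>\<^sup>+\<omega>. ennreal (c \<omega>) \<partial>\<pi>)"
    unfolding c_eq by (simp add: case_prod_beta')
  also have "\<dots> = ennreal (\<integral>\<omega>. c \<omega> \<partial>\<pi>)"
  proof (rule nn_integral_eq_integral)
    show "integrable \<pi> c" using int by (simp add: has_bochner_integral_iff)
    show "AE \<omega> in \<pi>. 0 \<le> c \<omega>" unfolding c_eq by simp
  qed
  finally have "enn2ereal (\<integral>\<^sup>+((x0, x1, y), (x0', x1', y')).
      ennreal ((norm (x0 - x0'))\<^sup>2 + (norm (x1 - x1'))\<^sup>2 + (norm (y - y'))\<^sup>2) \<partial>\<pi>)
      = ereal (\<integral>\<omega>. c \<omega> \<partial>\<pi>)"
    using Bochner_Integration.integral_nonneg[of \<pi> c] by (simp add: c_eq)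
  then show ?cost
    using int by (simp add: has_bochner_integral_iff a_def a'_def e_def e'_def)
  show ?initial if "pd S"
    using gelbrich_bound[OF a2 that Ha'2] psd_congruence[OF psd(6), of ?H]
    by (simp add: transpose_H_mat a_def a'_def matrix_mul_assoc)
  show ?noise if "pd Q" "pd R"
    using gelbrich_bound[OF e2 pd_sigma2[OF that] e'2 psd_sigma2[OF psd(4,5)]]
    by (simp add: e_def e'_def)
qed

section \<open>An optimal bicausal coupling\<close>

text \<open>The projection \<open>P\<close> onto the range of a symmetric matrix \<open>K\<close>, and the pseudo-inverse \<open>G\<close>.\<close>

lemma symmetric_pseudo_inverse:
  fixes K :: "real^'k^'k"
  assumes "transpose K = K"
  obtains G P where "G ** K = P" "K ** P = K" "transpose P = P" "P ** P = P"
proof -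
  obtain V d where V: "orthogonal_matrix V" and K: "K = V ** diag_matrix d ** transpose V"
    using spectral_decomposition[OF assms] by blast
  have mult: "(V ** diag_matrix b ** transpose V) ** (V ** diag_matrix c ** transpose V)
      = V ** diag_matrix (\<lambda>i. b i * c i) ** transpose V" for b c
  proof -
    have "(V ** diag_matrix b ** transpose V) ** (V ** diag_matrix c ** transpose V)
        = V ** (diag_matrix b ** (transpose V ** V) ** diag_matrix c) ** transpose V"
      by (simp add: matrix_mul_assoc)
    then show ?thesis using V by (simp add: orthogonal_matrix diag_matrix_mult)
  qed
  define f where "f i = (if d i = 0 then 0 else 1 :: real)" for i
  define P where "P = V ** diag_matrix f ** transpose V"
  \<comment> \<open>Division by zero yields zero, so inverting \<open>d\<close> entrywise leaves the kernel alone.\<close>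
  define G where "G = V ** diag_matrix (\<lambda>i. 1 / d i) ** transpose V"
  have "G ** K = P" unfolding G_def K P_def mult
    by (intro arg_cong[where f = "\<lambda>X. V ** diag_matrix X ** transpose V"]) (auto simp: f_def)
  moreover have "K ** P = K" unfolding K P_def mult
    by (intro arg_cong[where f = "\<lambda>X. V ** diag_matrix X ** transpose V"]) (auto simp: f_def)
  moreover have "P ** P = P" unfolding P_def mult
    by (intro arg_cong[where f = "\<lambda>X. V ** diag_matrix X ** transpose V"]) (auto simp: f_def)
  moreover have "transpose P = P" by (simp add: P_def matrix_transpose_mul matrix_mul_assoc)
  ultimately show thesis using that by blast
qed

text \<open>Replacing the component of a standard Gaussian vector orthogonal to the range of \<open>P\<close> by that of
  an independent copy preserves its law: this is the first half of an orthogonal transformation of the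
  pair.\<close>

lemma distr_std_gaussian_resample:
  fixes P :: "real^'k^'k"
  assumes tP: "transpose P = P" and PP: "P ** P = P"
  shows "distr (std_gaussian \<Otimes>\<^sub>M std_gaussian) borel (\<lambda>p. P *v fst p + (mat 1 - P) *v snd p) = std_gaussian"
proof -
  let ?PP = "(std_gaussian :: (real^'k) measure) \<Otimes>\<^sub>M (std_gaussian :: (real^'k) measure)"
  let ?I = "mat 1 :: real^'k^'k"
  define U where "U = block_matrix P (?I - P) (?I - P) P"
  have tI: "transpose (?I - P) = ?I - P"
    using tP by (simp add: transpose_def vec_eq_iff mat_def)
  have "transpose U ** U = block_matrix ?I 0 0 ?I"
    unfolding U_def transpose_block_matrix tP tI block_matrix_mult
    by (simp add: matrix_diff_ldistrib matrix_diff_rdistrib PP)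
  then have "orthogonal_matrix U" by (simp add: orthogonal_matrix block_matrix_id)
  note U = distr_std_gaussian_orthogonal[OF this]
  have upper: "distr (distr ?PP borel (\<lambda>p. stack (fst p) (snd p))) borel upper = std_gaussian"
    by (subst distr_distr) (auto simp: o_def distr_std_pair_fst)
  have "distr ?PP borel (\<lambda>p. P *v fst p + (?I - P) *v snd p)
      = distr (distr (distr ?PP borel (\<lambda>p. stack (fst p) (snd p))) borel ((*v) U)) borel upper"
    by (subst distr_distr, measurable, subst distr_distr, measurable)
      (simp add: o_def U_def block_matrix_mult_vec)
  also have "\<dots> = std_gaussian"
    using upper unfolding distr_std_gaussian_stack U .
  finally show ?thesis .
qed

text \<open>If \<open>X\<close> is a function of \<open>(a, c)\<close> and \<open>Y = g X b\<close> with \<open>b\<close> independent of \<open>(a, c)\<close>, then the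
  conditional law of \<open>Y\<close> given \<open>X = x\<close> is that of \<open>g x b\<close>.\<close>

lemma is_cond_law_independent_noise:
  fixes X :: "'w \<Rightarrow> 'x::second_countable_topology" and Y :: "'w \<Rightarrow> 'y::second_countable_topology"
    and M2 :: "'b::second_countable_topology measure"
  assumes M2: "prob_space M2" and M3: "sigma_finite_measure M3"
    and sets_M2[measurable_cong]: "sets M2 = sets borel"
    and F[measurable]: "F \<in> (M1 \<Otimes>\<^sub>M M2) \<Otimes>\<^sub>M M3 \<rightarrow>\<^sub>M N"
    and X[measurable]: "X \<in> borel_measurable N" and Y[measurable]: "Y \<in> borel_measurable N"
    and g[measurable]: "(\<lambda>p. g (fst p) (snd p)) \<in> borel_measurable borel"
    and h[measurable]: "(\<lambda>p. h (fst p) (snd p)) \<in> borel_measurable (M1 \<Otimes>\<^sub>M M3)"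
    and Xh: "\<And>a b c. X (F ((a, b), c)) = h a c" and Yg: "\<And>a b c. Y (F ((a, b), c)) = g (h a c) b"
  shows "is_cond_law (distr ((M1 \<Otimes>\<^sub>M M2) \<Otimes>\<^sub>M M3) N F) Y X (\<lambda>x. distr M2 borel (g x))"
  unfolding is_cond_law_def
proof (intro conjI ballI)
  interpret M2: prob_space M2 by fact
  interpret M3: sigma_finite_measure M3 by fact
  interpret M23: pair_sigma_finite M2 M3 ..
  have g1: "g x \<in> borel_measurable M2" for x
  proof -
    have "(\<lambda>b. (x, b)) \<in> borel_measurable M2" by measurable
    from measurable_compose[OF this g] show ?thesis by simp
  qed
  have gp: "(\<lambda>(x, b). g x b) \<in> borel \<Otimes>\<^sub>M M2 \<rightarrow>\<^sub>M borel"
  proof -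
    have "(\<lambda>p. p) \<in> borel \<Otimes>\<^sub>M M2 \<rightarrow>\<^sub>M (borel :: ('x \<times> 'b) measure)"
      unfolding borel_prod[symmetric] by measurable
    from measurable_compose[OF this g] show ?thesis by (simp add: case_prod_beta')
  qed
  show \<kappa>: "(\<lambda>x. distr M2 borel (g x)) \<in> borel \<rightarrow>\<^sub>M prob_algebra borel"
    by (rule measurable_distr_prob_space2[OF _ gp]) (simp add: space_prob_algebra M2)
  fix U B assume U[measurable]: "U \<in> sets (borel :: 'x measure)" and B[measurable]: "B \<in> sets (borel :: 'y measure)"
  let ?P = "(M1 \<Otimes>\<^sub>M M2) \<Otimes>\<^sub>M M3"
  let ?k = "\<lambda>x. emeasure (distr M2 borel (g x)) B"
  have [measurable]: "?k \<in> borel_measurable borel" by (rule kernel_emeasure_measurable[OF \<kappa> B])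
  have k: "?k x = (\<integral>\<^sup>+b. indicator B (g x b) \<partial>M2)" for x
    using nn_integral_indicator[of B "distr M2 borel (g x)"]
      nn_integral_distr[OF g1[of x], of "indicator B"]
    by simp
  have "emeasure (distr ?P N F) {\<omega> \<in> space (distr ?P N F). X \<omega> \<in> U \<and> Y \<omega> \<in> B}
      = (\<integral>\<^sup>+\<omega>. indicator {\<omega> \<in> space (distr ?P N F). X \<omega> \<in> U \<and> Y \<omega> \<in> B} \<omega> \<partial>distr ?P N F)"
    by (rule nn_integral_indicator[symmetric]) measurable
  also have "\<dots> = (\<integral>\<^sup>+\<omega>. indicator U (X \<omega>) * indicator B (Y \<omega>) \<partial>distr ?P N F)"
    by (rule nn_integral_cong) (auto simp: indicator_def)
  also have "\<dots> = (\<integral>\<^sup>+p. indicator U (X (F p)) * indicator B (Y (F p)) \<partial>?P)"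
    by (rule nn_integral_distr) auto
  also have "\<dots> = (\<integral>\<^sup>+q. \<integral>\<^sup>+c. indicator U (X (F (q, c))) * indicator B (Y (F (q, c))) \<partial>M3 \<partial>(M1 \<Otimes>\<^sub>M M2))"
    by (rule M3.nn_integral_fst[symmetric]) measurable
  also have "\<dots> = (\<integral>\<^sup>+a. \<integral>\<^sup>+b. \<integral>\<^sup>+c. indicator U (X (F ((a, b), c))) * indicator B (Y (F ((a, b), c))) \<partial>M3 \<partial>M2 \<partial>M1)"
    by (rule M2.nn_integral_fst[symmetric]) measurable
  also have "\<dots> = (\<integral>\<^sup>+a. \<integral>\<^sup>+b. \<integral>\<^sup>+c. indicator U (h a c) * ?k (h a c) \<partial>M3 \<partial>M2 \<partial>M1)"
  proof (rule nn_integral_cong)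
    fix a assume a: "a \<in> space M1"
    have ha[measurable]: "h a \<in> borel_measurable M3"
      using measurable_compose[OF measurable_Pair1'[OF a] h] by simp
    have gb: "(\<lambda>(b, c). g (h a c) b) \<in> borel_measurable (M2 \<Otimes>\<^sub>M M3)"
    proof -
      have "(\<lambda>p. (h a (snd p), fst p)) \<in> M2 \<Otimes>\<^sub>M M3 \<rightarrow>\<^sub>M borel" by measurable
      from measurable_compose[OF this g] show ?thesis by (simp add: case_prod_beta')
    qed
    have "(\<integral>\<^sup>+b. \<integral>\<^sup>+c. indicator U (X (F ((a, b), c))) * indicator B (Y (F ((a, b), c))) \<partial>M3 \<partial>M2)
        = (\<integral>\<^sup>+b. \<integral>\<^sup>+c. indicator U (h a c) * indicator B (g (h a c) b) \<partial>M3 \<partial>M2)"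
      by (simp add: Xh Yg)
    also have "\<dots> = (\<integral>\<^sup>+c. \<integral>\<^sup>+b. indicator U (h a c) * indicator B (g (h a c) b) \<partial>M2 \<partial>M3)"
      by (rule M23.Fubini'[symmetric]) (use gb in measurable)
    also have "\<dots> = (\<integral>\<^sup>+c. indicator U (h a c) * ?k (h a c) \<partial>M3)"
      unfolding k
      by (intro nn_integral_cong nn_integral_cmult
          measurable_compose[OF g1 borel_measurable_indicator] B)
    also have "\<dots> = (\<integral>\<^sup>+b. \<integral>\<^sup>+c. indicator U (h a c) * ?k (h a c) \<partial>M3 \<partial>M2)"
      by (simp add: M2.emeasure_space_1)
    finally show "(\<integral>\<^sup>+b. \<integral>\<^sup>+c. indicator U (X (F ((a, b), c))) * indicator B (Y (F ((a, b), c))) \<partial>M3 \<partial>M2)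
        = (\<integral>\<^sup>+b. \<integral>\<^sup>+c. indicator U (h a c) * ?k (h a c) \<partial>M3 \<partial>M2)" .
  qed
  also have "\<dots> = (\<integral>\<^sup>+a. \<integral>\<^sup>+b. \<integral>\<^sup>+c. indicator U (X (F ((a, b), c))) * ?k (X (F ((a, b), c))) \<partial>M3 \<partial>M2 \<partial>M1)"
    by (simp add: Xh)
  also have "\<dots> = (\<integral>\<^sup>+q. \<integral>\<^sup>+c. indicator U (X (F (q, c))) * ?k (X (F (q, c))) \<partial>M3 \<partial>(M1 \<Otimes>\<^sub>M M2))"
    by (rule M2.nn_integral_fst) measurable
  also have "\<dots> = (\<integral>\<^sup>+p. indicator U (X (F p)) * ?k (X (F p)) \<partial>?P)"
    by (rule M3.nn_integral_fst) measurable
  also have "\<dots> = (\<integral>\<^sup>+\<omega>. indicator U (X \<omega>) * ?k (X \<omega>) \<partial>distr ?P N F)"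
    by (rule nn_integral_distr[symmetric]) auto
  finally show "emeasure (distr ?P N F) {\<omega> \<in> space (distr ?P N F). X \<omega> \<in> U \<and> Y \<omega> \<in> B}
      = (\<integral>\<^sup>+\<omega>. indicator U (X \<omega>) * ?k (X \<omega>) \<partial>distr ?P N F)" .
qed

lemma distr_path_map:
  fixes A :: "real^'n^'n" and C :: "real^'n^'m"
  assumes M2: "prob_space M2" and [measurable]: "f \<in> borel_measurable M1" "g \<in> borel_measurable M2"
    and f: "distr M1 borel f = std_gaussian" and g: "distr M2 borel g = std_gaussian"
  shows "distr (M1 \<Otimes>\<^sub>M M2) borel (\<lambda>p. path_map A C xhat Q R S (f (fst p), g (snd p)))
    = state_obs_law A C xhat Q R S"
proof -
  have "(std_gaussian :: (real^'n) measure) \<Otimes>\<^sub>M (std_gaussian :: (real^('n + 'm)) measure)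
      = distr M1 borel f \<Otimes>\<^sub>M distr M2 borel g"
    by (simp add: f g)
  also have "\<dots> = distr (M1 \<Otimes>\<^sub>M M2) (borel \<Otimes>\<^sub>M borel) (\<lambda>(x, y). (f x, g y))"
    by (rule pair_measure_distr)
      (auto intro!: prob_space_imp_sigma_finite prob_space.prob_space_distr[OF M2])
  finally have "state_obs_law A C xhat Q R S
      = distr (distr (M1 \<Otimes>\<^sub>M M2) (borel \<Otimes>\<^sub>M borel) (\<lambda>(x, y). (f x, g y))) borel (path_map A C xhat Q R S)"
    by (simp add: state_obs_law_eq)
  also have "\<dots> = distr (M1 \<Otimes>\<^sub>M M2) borel (\<lambda>p. path_map A C xhat Q R S (f (fst p), g (snd p)))"
    unfolding borel_prod by (subst distr_distr) (auto simp: o_def case_prod_beta')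
  finally show ?thesis by simp
qed

lemma has_second_moment_of_std:
  assumes "f \<in> borel_measurable M" and "distr M borel f = std_gaussian"
  shows "has_second_moment M f (mat 1)"
proof -
  have "has_second_moment (distr M borel f) (\<lambda>z. z) (mat 1)"
    unfolding assms(2) by (rule std_gaussian_second_moment)
  then show ?thesis
    using has_second_moment_distr[OF assms(1), of "\<lambda>z. z" "mat 1"] by simp
qed

text \<open>The coupling attaining both Gelbrich bounds. The standardised noises of the two paths are
  orthogonal images of one vector \<open>c\<close>, the orthogonal matrices coming from polar decompositions. The
  second initial state is \<open>xhat + sqrt S' a\<close>. As \<open>sqrt S'\<close> may be singular, only the projection \<open>P a\<close>
  can be recovered from it; the first initial state is a function of \<open>y = P a + (1 - P) b\<close> with \<open>b\<close>
  independent of \<open>a\<close>. This makes its conditional law given the second path explicit, while \<open>sqrt S' y =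
  sqrt S' a\<close> keeps the second initial state a function of the first.\<close>

theorem optimal_bicausal_coupling:
  fixes A :: "real^'n^'n" and C :: "real^'n^'m"
  assumes S: "pd S" and psd: "psd Q" "psd R" "psd Q'" "psd R'" "psd S'"
  obtains \<pi> where "\<pi> \<in> bicausal_couplings (state_obs_law A C xhat Q R S) (state_obs_law A C xhat Q' R' S')"
    "(\<integral>\<omega>. (fst (fst \<omega>) - xhat) \<bullet> (H_mat A C *v (fst (snd \<omega>) - xhat)) \<partial>\<pi>)
      = trace (psd_sqrt (psd_sqrt S ** H_mat A C ** S' ** H_mat A C ** psd_sqrt S))"
    "(\<integral>\<omega>. path_noise A C (fst \<omega>) \<bullet> path_noise A C (snd \<omega>) \<partial>\<pi>)
      = trace (psd_sqrt (psd_sqrt (sigma2 C Q R) ** sigma2 C Q' R' ** psd_sqrt (sigma2 C Q R)))"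
proof -
  let ?H = "H_mat A C" and ?I = "mat 1 :: real^'n^'n"
  define B where "B = psd_sqrt S"
  define K where "K = psd_sqrt S'"
  have tB: "transpose B = B" using S by (simp add: B_def transpose_psd_sqrt pd_imp_psd)
  have tK: "transpose K = K" and KK: "K ** K = S'"
    using psd by (auto simp: K_def transpose_psd_sqrt psd_sqrt_square)
  obtain T where TB: "T ** B = ?I"
    using invertible_psd_sqrt[OF S] unfolding invertible_def B_def by blast
  obtain G P where GK: "G ** K = P" and KP: "K ** P = K" and tP: "transpose P = P" and PP: "P ** P = P"
    using symmetric_pseudo_inverse[OF tK] by metis
  obtain W where W: "orthogonal_matrix W"
    and rootW: "psd_sqrt ((B ** ?H ** K) ** transpose (B ** ?H ** K)) = B ** ?H ** K ** W"
    by (rule polar_decomposition)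
  have WW: "W ** transpose W = ?I" using W by (simp add: orthogonal_matrix_def)
  define L where "L = noise_factor C Q R"
  define L' where "L' = noise_factor C Q' R'"
  define V where "V = psd_sqrt (sigma2 C Q R)"
  have tV: "transpose V = V" using psd by (simp add: V_def transpose_psd_sqrt psd_sigma2)
  obtain U where U: "orthogonal_matrix U" and VU: "V = L ** U"
    using polar_decomposition[of L] psd by (metis L_def V_def noise_factor_square)
  obtain U' where U': "orthogonal_matrix U'"
    and rootU': "psd_sqrt ((V ** L') ** transpose (V ** L')) = V ** L' ** U'"
    by (rule polar_decomposition)

  let ?N = "std_gaussian :: (real^'n) measure" and ?N' = "std_gaussian :: (real^('n + 'm)) measure"
  define \<Omega> where "\<Omega> = (?N \<Otimes>\<^sub>M ?N) \<Otimes>\<^sub>M ?N'"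
  define y where "y p = P *v fst p + (?I - P) *v snd p" for p :: "(real^'n) \<times> (real^'n)"
  define Z where "Z \<omega> = path_map A C xhat Q R S (transpose W *v y (fst \<omega>), U *v snd \<omega>)"
    for \<omega> :: "((real^'n) \<times> (real^'n)) \<times> (real^('n + 'm))"
  define Z' where "Z' \<omega> = path_map A C xhat Q' R' S' (fst (fst \<omega>), U' *v snd \<omega>)"
    for \<omega> :: "((real^'n) \<times> (real^'n)) \<times> (real^('n + 'm))"
  define F where "F \<omega> = (Z \<omega>, Z' \<omega>)" for \<omega>
  define \<pi> where "\<pi> = distr \<Omega> borel F"

  have NN: "prob_space (?N \<Otimes>\<^sub>M ?N)" and \<Omega>: "prob_space \<Omega>"
    unfolding \<Omega>_def by (intro prob_space_pair prob_space_std_gaussian)+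
  have y_m[measurable]: "y \<in> borel_measurable (?N \<Otimes>\<^sub>M ?N)" unfolding y_def[abs_def] by measurable
  have "sets \<Omega> = sets borel"
    unfolding \<Omega>_def borel_prod[symmetric] by (intro sets_pair_measure_cong) simp_all
  then have sets_\<Omega>[measurable_cong]: "sets \<Omega> = sets borel" .
  have [measurable]: "y \<in> borel_measurable borel" unfolding y_def[abs_def] by measurable
  have Z_m[measurable]: "Z \<in> borel_measurable \<Omega>" and Z'_m[measurable]: "Z' \<in> borel_measurable \<Omega>"
    unfolding Z_def[abs_def] Z'_def[abs_def] by measurable
  have F_m[measurable]: "F \<in> borel_measurable \<Omega>" unfolding F_def[abs_def] by measurable
  have sets_\<pi>[measurable_cong]: "sets \<pi> = sets borel" by (simp add: \<pi>_def)

  have y_law: "distr (?N \<Otimes>\<^sub>M ?N) borel y = std_gaussian"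
    using distr_std_gaussian_resample[OF tP PP] by (simp add: y_def[abs_def])
  have Wy_law: "distr (?N \<Otimes>\<^sub>M ?N) borel (\<lambda>p. transpose W *v y p) = std_gaussian"
  proof -
    have "distr (?N \<Otimes>\<^sub>M ?N) borel (\<lambda>p. transpose W *v y p)
        = distr (distr (?N \<Otimes>\<^sub>M ?N) borel y) borel ((*v) (transpose W))"
      by (subst distr_distr) (auto simp: o_def)
    then show ?thesis unfolding y_law using W by (simp only: distr_std_gaussian_orthogonal orthogonal_matrix_transpose)
  qed
  have law: "distr \<Omega> borel Z = state_obs_law A C xhat Q R S"
    unfolding \<Omega>_def Z_def[abs_def]
    by (rule distr_path_map[OF prob_space_std_gaussian _ _ Wy_law distr_std_gaussian_orthogonal[OF U]]) measurable
  have law': "distr \<Omega> borel Z' = state_obs_law A C xhat Q' R' S'"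
    unfolding \<Omega>_def Z'_def[abs_def]
    by (rule distr_path_map[OF prob_space_std_gaussian _ _ distr_std_pair_fst distr_std_gaussian_orthogonal[OF U']]) measurable
  have coupling: "\<pi> \<in> couplings (state_obs_law A C xhat Q R S) (state_obs_law A C xhat Q' R' S')"
  proof -
    have "distr \<pi> borel fst = distr \<Omega> borel Z" "distr \<pi> borel snd = distr \<Omega> borel Z'"
      unfolding \<pi>_def by (subst distr_distr; auto simp: o_def F_def)+
    then show ?thesis
      using prob_space.prob_space_distr[OF \<Omega> F_m]
      by (simp add: couplings_def law law' space_prob_algebra \<pi>_def)
  qed

  have Ky: "K *v y p = K *v fst p" for p
    by (simp add: y_def matrix_vector_right_distrib matrix_vector_mul_assoc matrix_diff_ldistrib KP)
  have x0: "fst (Z \<omega>) = xhat + B *v (transpose W *v y (fst \<omega>))" for \<omega>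
    by (simp add: Z_def fst_path_map B_def)
  have x0': "fst (Z' \<omega>) = xhat + K *v fst (fst \<omega>)" for \<omega>
    by (simp add: Z'_def fst_path_map K_def)

  \<comment> \<open>\<open>f\<close> recovers the second initial state from the first one.\<close>
  define f where "f x = xhat + K *v (W *v (T *v (x - xhat)))" for x
  have [measurable]: "f \<in> borel_measurable borel" unfolding f_def[abs_def] by measurable
  have "fst (Z' \<omega>) = f (fst (Z \<omega>))" for \<omega>
  proof -
    have "W *v (T *v (B *v (transpose W *v v))) = v" for v
      using WW TB by (metis matrix_mul_lid matrix_vector_mul_assoc matrix_vector_mul_lid)
    then show ?thesis by (simp add: f_def x0 x0' Ky del: transpose_matrix_vector)
  qed
  then have det: "AE \<omega> in \<pi>. (fst \<circ> snd) \<omega> = f ((fst \<circ> fst) \<omega>)"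
    unfolding \<pi>_def by (subst AE_distr_iff) (auto simp: F_def)
  have same: "same_cond_law \<pi> (fst \<circ> snd) fst (fst \<circ> fst)"
    unfolding same_cond_law_def
  proof (intro exI conjI)
    show "is_cond_law \<pi> (fst \<circ> snd) fst (\<lambda>p. return borel (f (fst p)))"
      by (rule is_cond_law_deterministic) (use det in \<open>auto simp: o_def\<close>)
    show "is_cond_law \<pi> (fst \<circ> snd) (fst \<circ> fst) (\<lambda>x. return borel (f x))"
      by (rule is_cond_law_deterministic) (use det in \<open>auto simp: o_def\<close>)
  qed auto

  \<comment> \<open>\<open>g x b\<close> is the first initial state when the second one is \<open>x\<close> and the resampled vector is \<open>b\<close>.\<close>
  define g where "g x b = xhat + B *v (transpose W *v (G *v (x - xhat) + (?I - P) *v b))" for x b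
  have g: "fst (Z ((a, b), c)) = g (xhat + K *v a) b" for a b c
    by (simp add: x0 y_def g_def matrix_vector_mul_assoc GK del: transpose_matrix_vector)
  have same': "same_cond_law \<pi> (fst \<circ> fst) snd (fst \<circ> snd)"
    unfolding same_cond_law_def
  proof (intro exI conjI)
    show "is_cond_law \<pi> (fst \<circ> fst) snd (\<lambda>p. distr ?N borel (g (fst p)))"
      unfolding \<pi>_def \<Omega>_def
      \<comment> \<open>The second path does not depend on \<open>b\<close>, so any value may be put in its place.\<close>
    proof (rule is_cond_law_independent_noise[where h = "\<lambda>a c. Z' ((a, 0), c)"])
      show "(\<lambda>p. g (fst (fst p)) (snd p)) \<in> borel_measurable borel"
        unfolding g_def[abs_def] by measurable
      show "(\<lambda>p. Z' ((fst p, 0), snd p)) \<in> borel_measurable (?N \<Otimes>\<^sub>M ?N')"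
        unfolding Z'_def[abs_def] by measurable
      show "snd (F ((a, b), c)) = Z' ((a, 0), c)" for a b c
        by (simp add: F_def Z'_def)
      show "(fst \<circ> fst) (F ((a, b), c)) = g (fst (Z' ((a, 0), c))) b" for a b c
        by (simp add: F_def g x0')
    qed (use F_m in \<open>auto simp: o_def \<Omega>_def intro: prob_space_std_gaussian prob_space_imp_sigma_finite\<close>)
    show "is_cond_law \<pi> (fst \<circ> fst) (fst \<circ> snd) (\<lambda>x. distr ?N borel (g x))"
      unfolding \<pi>_def \<Omega>_def
    proof (rule is_cond_law_independent_noise[where h = "\<lambda>a c. xhat + K *v a"])
      show "(\<lambda>p. g (fst p) (snd p)) \<in> borel_measurable borel"
        unfolding g_def[abs_def] by measurable
      show "(fst \<circ> snd) (F ((a, b), c)) = xhat + K *v a" for a b c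
        by (simp add: F_def x0')
      show "(fst \<circ> fst) (F ((a, b), c)) = g (xhat + K *v a) b" for a b c
        by (simp add: F_def g)
    qed (use F_m in \<open>auto simp: o_def \<Omega>_def intro: prob_space_std_gaussian prob_space_imp_sigma_finite\<close>)
  qed auto

  have "distr \<Omega> borel (\<lambda>\<omega>. y (fst \<omega>)) = distr (distr \<Omega> (?N \<Otimes>\<^sub>M ?N) fst) borel y"
    unfolding \<Omega>_def by (subst distr_distr) (auto simp: o_def)
  also have "\<dots> = std_gaussian"
    unfolding \<Omega>_def prob_space.distr_pair_fst[OF prob_space_std_gaussian] by (rule y_law)
  finally have y2: "has_second_moment \<Omega> (\<lambda>\<omega>. y (fst \<omega>)) (mat 1)"
    by (intro has_second_moment_of_std) measurable
  have "distr \<Omega> borel snd = std_gaussian"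
    using distr_pair_snd[OF NN prob_space_std_gaussian] unfolding \<Omega>_def by (simp cong: distr_cong)
  then have c2: "has_second_moment \<Omega> snd (mat 1)"
    by (intro has_second_moment_of_std) measurable

  have "(\<integral>\<omega>. (fst (fst \<omega>) - xhat) \<bullet> (?H *v (fst (snd \<omega>) - xhat)) \<partial>\<pi>)
      = (\<integral>\<omega>. (fst (Z \<omega>) - xhat) \<bullet> (?H *v (fst (Z' \<omega>) - xhat)) \<partial>\<Omega>)"
    unfolding \<pi>_def by (subst integral_distr) (auto simp: F_def)
  also have "\<dots> = (\<integral>\<omega>. y (fst \<omega>) \<bullet> ((W ** B ** ?H ** K) *v y (fst \<omega>)) \<partial>\<Omega>)"
    by (simp add: x0 x0' Ky[symmetric] mult_dot_transpose matrix_transpose_mul tB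
        matrix_vector_mul_assoc matrix_mul_assoc del: transpose_matrix_vector)
  also have "\<dots> = trace (W ** (B ** ?H ** K))"
    using has_second_moment_quadratic_form[OF y2] by (simp add: has_bochner_integral_iff matrix_mul_assoc)
  also have "\<dots> = trace (B ** ?H ** K ** W)" by (rule trace_mul_sym)
  also have "\<dots> = trace (psd_sqrt (B ** ?H ** S' ** ?H ** B))"
    using rootW by (simp add: matrix_transpose_mul tB tK transpose_H_mat
        matrix_mul_assoc flip: KK)
  finally have initial: "(\<integral>\<omega>. (fst (fst \<omega>) - xhat) \<bullet> (?H *v (fst (snd \<omega>) - xhat)) \<partial>\<pi>)
      = trace (psd_sqrt (B ** ?H ** S' ** ?H ** B))" .

  have "(\<integral>\<omega>. path_noise A C (fst \<omega>) \<bullet> path_noise A C (snd \<omega>) \<partial>\<pi>)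
      = (\<integral>\<omega>. path_noise A C (Z \<omega>) \<bullet> path_noise A C (Z' \<omega>) \<partial>\<Omega>)"
    unfolding \<pi>_def by (subst integral_distr) (auto simp: F_def)
  also have "\<dots> = (\<integral>\<omega>. snd \<omega> \<bullet> ((V ** L' ** U') *v snd \<omega>) \<partial>\<Omega>)"
  proof -
    have "path_noise A C (Z \<omega>) \<bullet> path_noise A C (Z' \<omega>) = (V *v snd \<omega>) \<bullet> ((L' ** U') *v snd \<omega>)" for \<omega>
      by (simp add: Z_def Z'_def path_noise_path_map L_def[symmetric] L'_def[symmetric] VU matrix_vector_mul_assoc)
    then show ?thesis
      by (simp add: mult_dot_transpose tV matrix_vector_mul_assoc matrix_mul_assoc del: transpose_matrix_vector)
  qed
  also have "\<dots> = trace (V ** L' ** U')"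
    using has_second_moment_quadratic_form[OF c2] by (simp add: has_bochner_integral_iff)
  also have "\<dots> = trace (psd_sqrt (V ** sigma2 C Q' R' ** V))"
  proof -
    have "L' ** transpose L' = sigma2 C Q' R'"
      unfolding L'_def by (rule noise_factor_square[OF psd(3,4)])
    then have "(V ** L') ** transpose (V ** L') = V ** sigma2 C Q' R' ** V"
      by (metis matrix_mul_assoc matrix_transpose_mul tV)
    then show ?thesis by (simp only: rootU'[symmetric])
  qed
  finally have noise: "(\<integral>\<omega>. path_noise A C (fst \<omega>) \<bullet> path_noise A C (snd \<omega>) \<partial>\<pi>)
      = trace (psd_sqrt (V ** sigma2 C Q' R' ** V))" .
  show thesis
    by (rule that[of \<pi>])
      (use coupling same same' initial noise in \<open>auto simp: bicausal_couplings_def B_def V_def\<close>)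
qed

section \<open>The bicausal Wasserstein distance\<close>

theorem lemma2p2:
  fixes A :: "real^'n^'n" and C :: "real^'n^'m" and xhat :: "real^'n"
    and Q S Qbar Sbar :: "real^'n^'n" and R Rbar :: "real^'m^'m"
  assumes "pd Q" and "pd R" and "pd S"
    and "pd (covariance_matrix (state_obs_law A C xhat Q R S) (\<lambda>(x0, x1, y). stack x1 y))"
    and "psd Qbar" and "psd Rbar" and "psd Sbar"
  shows "enn2ereal (W_bc (state_obs_law A C xhat Q R S) (state_obs_law A C xhat Qbar Rbar Sbar))
         = ereal (w_formula A C Q R S Qbar Rbar Sbar)"
proof -
  let ?\<Pi> = "bicausal_couplings (state_obs_law A C xhat Q R S) (state_obs_law A C xhat Qbar Rbar Sbar)"
  let ?cost = "\<lambda>\<pi>. \<integral>\<^sup>+((x0, x1, y), (x0', x1', y')).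
    ennreal ((norm (x0 - x0'))\<^sup>2 + (norm (x1 - x1'))\<^sup>2 + (norm (y - y'))\<^sup>2) \<partial>\<pi>"
  note psd = pd_imp_psd[OF assms(1)] pd_imp_psd[OF assms(2)] pd_imp_psd[OF assms(3)] assms(5-7)
  have w: "w_formula A C Q R S Qbar Rbar Sbar
      = trace (H_mat A C ** S) + trace (H_mat A C ** Sbar)
        - 2 * trace (psd_sqrt (psd_sqrt S ** H_mat A C ** Sbar ** H_mat A C ** psd_sqrt S))
        + trace (sigma2 C Q R) + trace (sigma2 C Qbar Rbar)
        - 2 * trace (psd_sqrt (psd_sqrt (sigma2 C Q R) ** sigma2 C Qbar Rbar ** psd_sqrt (sigma2 C Q R)))"
    by (simp add: w_formula_def trace_add trace_sub trace_scaleR)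
  obtain \<pi> where \<pi>: "\<pi> \<in> ?\<Pi>"
    "(\<integral>\<omega>. (fst (fst \<omega>) - xhat) \<bullet> (H_mat A C *v (fst (snd \<omega>) - xhat)) \<partial>\<pi>)
      = trace (psd_sqrt (psd_sqrt S ** H_mat A C ** Sbar ** H_mat A C ** psd_sqrt S))"
    "(\<integral>\<omega>. path_noise A C (fst \<omega>) \<bullet> path_noise A C (snd \<omega>) \<partial>\<pi>)
      = trace (psd_sqrt (psd_sqrt (sigma2 C Q R) ** sigma2 C Qbar Rbar ** psd_sqrt (sigma2 C Q R)))"
    by (rule optimal_bicausal_coupling[OF assms(3) psd(1,2,4,5,6), of A C xhat])
  have cost_\<pi>: "enn2ereal (?cost \<pi>) = ereal (w_formula A C Q R S Qbar Rbar Sbar)"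
    unfolding w bicausal_coupling_cost(1)[OF \<pi>(1) psd] \<pi>(2,3) ..
  have "?cost \<pi> \<le> ?cost \<rho>" if \<rho>: "\<rho> \<in> ?\<Pi>" for \<rho>
    unfolding less_eq_ennreal.rep_eq cost_\<pi> w bicausal_coupling_cost(1)[OF \<rho> psd]
    using bicausal_coupling_cost(2)[OF \<rho> psd assms(3)] bicausal_coupling_cost(3)[OF \<rho> psd assms(1,2)]
    by simp
  then have "W_bc (state_obs_law A C xhat Q R S) (state_obs_law A C xhat Qbar Rbar Sbar) = ?cost \<pi>"
    unfolding W_bc_def using \<pi>(1) by (intro antisym INF_lower INF_greatest)
  then show ?thesis by (simp only: cost_\<pi>)
qed

end
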